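(* Let $G,H$ be countable groups. If $G$ and $H$ have the Haagerup Property, then so does the standard wreath product $H\wr G$.
   Context: A countable group is Haagerup (has the Haagerup Property) if it admits a metrically proper isometric action on a Hilbert space. The standard wreath product is $H\wr G=H^{(G)}\rtimes G$, where $H^{(G)}=\bigoplus_{g\in G}H$ is the direct sum of copies of $H$ indexed by $G$ (finitely supported functions $G\to H$) and $G$ acts by shifting the copies: $(g\cdot w)(g')=w(g^{-1}g')$. *)

theory Defs
  imports
    "HOL-Analysis.Analysis"
    "HOL-Algebra.Product_Groups"
    "HOL-Algebra.Group_Action"
begin

section \<open>The Hilbert space of square-summable real sequences\<close>

typedef ell2 = "{f :: nat \<Rightarrow> real. summable (\<lambda>n. (f n)\<^sup>2)}"
  morphisms ell2_nth Abs_ell2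
  by (rule exI[of _ "\<lambda>_. 0"]) simp

setup_lifting type_definition_ell2

lemma summable_ell2_nth_sq: "summable (\<lambda>n. (ell2_nth x n)\<^sup>2)"
  using ell2_nth[of x] by simp

lemma summable_mult_of_sq:
  fixes f g :: "nat \<Rightarrow> real"
  assumes "summable (\<lambda>n. (f n)\<^sup>2)" "summable (\<lambda>n. (g n)\<^sup>2)"
  shows "summable (\<lambda>n. f n * g n)"
proof (rule summable_comparison_test)
  show "summable (\<lambda>n. (f n)\<^sup>2 + (g n)\<^sup>2)"
    using assms by (rule summable_add)
  have "\<bar>a * b\<bar> \<le> a\<^sup>2 + b\<^sup>2" for a b :: real
  proof -
    have "2 * (\<bar>a\<bar> * \<bar>b\<bar>) \<le> a\<^sup>2 + b\<^sup>2"
      using sum_squares_bound[of "\<bar>a\<bar>" "\<bar>b\<bar>"] by simp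
    moreover have "0 \<le> \<bar>a\<bar> * \<bar>b\<bar>" by simp
    ultimately show ?thesis unfolding abs_mult by linarith
  qed
  then show "\<exists>N. \<forall>n\<ge>N. norm (f n * g n) \<le> (f n)\<^sup>2 + (g n)\<^sup>2"
    by (simp only: real_norm_def) blast
qed

lemma summable_add_sq:
  fixes f g :: "nat \<Rightarrow> real"
  assumes "summable (\<lambda>n. (f n)\<^sup>2)" "summable (\<lambda>n. (g n)\<^sup>2)"
  shows "summable (\<lambda>n. (f n + g n)\<^sup>2)"
proof -
  have "summable (\<lambda>n. (f n)\<^sup>2 + (g n)\<^sup>2 + 2 * (f n * g n))"
    by (intro summable_add summable_mult assms summable_mult_of_sq)
  then show ?thesis by (simp add: power2_sum mult.assoc)
qed

instantiation ell2 :: real_vector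
begin

lift_definition zero_ell2 :: ell2 is "\<lambda>_. 0" by simp
lift_definition plus_ell2 :: "ell2 \<Rightarrow> ell2 \<Rightarrow> ell2" is "\<lambda>f g n. f n + g n"
  by (rule summable_add_sq)
lift_definition uminus_ell2 :: "ell2 \<Rightarrow> ell2" is "\<lambda>f n. - f n" by simp
lift_definition minus_ell2 :: "ell2 \<Rightarrow> ell2 \<Rightarrow> ell2" is "\<lambda>f g n. f n - g n"
  subgoal for f g using summable_add_sq[of f "\<lambda>n. - g n"] by simp
  done
lift_definition scaleR_ell2 :: "real \<Rightarrow> ell2 \<Rightarrow> ell2" is "\<lambda>c f n. c * f n"
  by (simp add: power_mult_distrib summable_mult)

instance
  by standard (transfer; simp add: algebra_simps fun_eq_iff)+

end

instantiation ell2 :: real_inner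
begin

definition inner_ell2 :: "ell2 \<Rightarrow> ell2 \<Rightarrow> real" where
  "inner_ell2 x y = (\<Sum>n. ell2_nth x n * ell2_nth y n)"

definition norm_ell2 :: "ell2 \<Rightarrow> real" where
  "norm_ell2 x = sqrt (inner x x)"

definition dist_ell2 :: "ell2 \<Rightarrow> ell2 \<Rightarrow> real" where
  "dist_ell2 x y = norm (x - y)"

definition sgn_ell2 :: "ell2 \<Rightarrow> ell2" where
  "sgn_ell2 x = x /\<^sub>R norm x"

definition uniformity_ell2 :: "(ell2 \<times> ell2) filter" where
  "uniformity_ell2 = (INF e\<in>{0<..}. principal {(x, y). dist x y < e})"

definition open_ell2 :: "ell2 set \<Rightarrow> bool" where
  "open_ell2 U = (\<forall>x\<in>U. eventually (\<lambda>(x', y). x' = x \<longrightarrow> y \<in> U) uniformity)"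

instance
proof
  fix x y z :: ell2 and r :: real and U :: "ell2 set"
  note summ = summable_mult_of_sq[OF summable_ell2_nth_sq summable_ell2_nth_sq]
  show "dist x y = norm (x - y)" by (simp add: dist_ell2_def)
  show "sgn x = x /\<^sub>R norm x" by (simp add: sgn_ell2_def)
  show "uniformity = (INF e\<in>{0<..}. principal {(x, y :: ell2). dist x y < e})"
    by (simp add: uniformity_ell2_def)
  show "open U = (\<forall>x\<in>U. eventually (\<lambda>(x', y). x' = x \<longrightarrow> y \<in> U) uniformity)"
    by (simp add: open_ell2_def)
  show "inner x y = inner y x"
    by (simp add: inner_ell2_def mult.commute)
  show "inner (x + y) z = inner x z + inner y z"
    using suminf_add[OF summ[of x z] summ[of y z]]
    by (simp add: inner_ell2_def plus_ell2.rep_eq distrib_right)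
  show "inner (r *\<^sub>R x) y = r * inner x y"
    using suminf_mult[OF summ[of x y], of r]
    by (simp add: inner_ell2_def scaleR_ell2.rep_eq mult.assoc)
  show "0 \<le> inner x x"
    unfolding inner_ell2_def by (intro suminf_nonneg summ) simp
  show "inner x x = 0 \<longleftrightarrow> x = 0"
    unfolding inner_ell2_def
    by (subst suminf_eq_zero_iff[OF summ])
       (auto simp: zero_ell2.rep_eq ell2_nth_inject[symmetric] fun_eq_iff)
  show "norm x = sqrt (inner x x)" by (simp add: norm_ell2_def)
qed

end

lemma sum_ell2_nth_sq_le_norm: "(\<Sum>i<n. (ell2_nth x i)\<^sup>2) \<le> (norm x)\<^sup>2"
  using sum_le_suminf[OF summable_ell2_nth_sq[of x], of "{..<n}"]
  unfolding power2_norm_eq_inner inner_ell2_def by (simp add: power2_eq_square)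

lemma abs_ell2_nth_le_norm: "\<bar>ell2_nth x i\<bar> \<le> norm x"
proof -
  have "(ell2_nth x i)\<^sup>2 \<le> (\<Sum>j<Suc i. (ell2_nth x j)\<^sup>2)"
    by (rule member_le_sum) auto
  then have "\<bar>ell2_nth x i\<bar>\<^sup>2 \<le> (norm x)\<^sup>2"
    using sum_ell2_nth_sq_le_norm[where x=x and n="Suc i"] by simp
  then show ?thesis
    by (rule power2_le_imp_le) simp
qed

instance ell2 :: complete_space
proof
  fix X :: "nat \<Rightarrow> ell2"
  assume X: "Cauchy X"
  have "Cauchy (\<lambda>m. ell2_nth (X m) i)" for i
  proof (rule metric_CauchyI)
    fix e :: real assume "e > 0"
    then obtain M where M: "\<And>m n. m \<ge> M \<Longrightarrow> n \<ge> M \<Longrightarrow> dist (X m) (X n) < e"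
      using metric_CauchyD[OF X] by blast
    have "dist (ell2_nth (X m) i) (ell2_nth (X n) i) \<le> dist (X m) (X n)" for m n
      using abs_ell2_nth_le_norm[of "X m - X n" i]
      by (simp add: dist_real_def dist_norm minus_ell2.rep_eq)
    then show "\<exists>M. \<forall>m\<ge>M. \<forall>n\<ge>M. dist (ell2_nth (X m) i) (ell2_nth (X n) i) < e"
      using M by (meson le_less_trans)
  qed
  then have "\<exists>f. \<forall>i. (\<lambda>m. ell2_nth (X m) i) \<longlonglongrightarrow> f i"
    by (intro choice) (simp add: Cauchy_convergent_iff convergent_def)
  then obtain f where f: "\<And>i. (\<lambda>m. ell2_nth (X m) i) \<longlonglongrightarrow> f i"
    by blast
  have part: "(\<Sum>i<k. (ell2_nth (X m) i - f i)\<^sup>2) \<le> e\<^sup>2"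
    if "e > 0" "\<And>n. n \<ge> M \<Longrightarrow> dist (X m) (X n) < e" for e m M k
  proof (rule LIMSEQ_le_const2)
    show "(\<lambda>n. \<Sum>i<k. (ell2_nth (X m) i - ell2_nth (X n) i)\<^sup>2) \<longlonglongrightarrow> (\<Sum>i<k. (ell2_nth (X m) i - f i)\<^sup>2)"
      by (intro tendsto_intros f)
    have "(\<Sum>i<k. (ell2_nth (X m) i - ell2_nth (X n) i)\<^sup>2) \<le> e\<^sup>2" if n: "n \<ge> M" for n
    proof -
      have "(norm (X m - X n))\<^sup>2 \<le> e\<^sup>2"
        using that(1) \<open>\<And>n. n \<ge> M \<Longrightarrow> dist (X m) (X n) < e\<close>[OF n]
        by (intro power_mono) (auto simp: dist_norm)
      then show ?thesis
        using sum_ell2_nth_sq_le_norm[where x="X m - X n" and n=k]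
        by (simp add: minus_ell2.rep_eq)
    qed
    then show "\<exists>N. \<forall>n\<ge>N. (\<Sum>i<k. (ell2_nth (X m) i - ell2_nth (X n) i)\<^sup>2) \<le> e\<^sup>2"
      by blast
  qed
  have summ: "summable (\<lambda>i. (ell2_nth (X m) i - f i)\<^sup>2)"
    if "e > 0" "\<And>n. n \<ge> M \<Longrightarrow> dist (X m) (X n) < e" for e m M
    using part[OF that] by (intro summableI_nonneg_bounded[where x="e\<^sup>2"]) auto
  obtain M1 where M1: "\<And>m n. m \<ge> M1 \<Longrightarrow> n \<ge> M1 \<Longrightarrow> dist (X m) (X n) < 1"
    using metric_CauchyD[OF X, of 1] by auto
  have "summable (\<lambda>i. (f i)\<^sup>2)"
    using summable_add_sq[OF summable_ell2_nth_sq[of "X M1"], of "\<lambda>i. - (ell2_nth (X M1) i - f i)"]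
      summ[of 1 M1 M1] M1
    by (simp add: power2_commute)
  then have F: "ell2_nth (Abs_ell2 f) = f"
    by (simp add: Abs_ell2_inverse)
  have "X \<longlonglongrightarrow> Abs_ell2 f"
  proof (rule metric_LIMSEQ_I)
    fix r :: real assume r: "r > 0"
    then obtain M where M: "\<And>m n. m \<ge> M \<Longrightarrow> n \<ge> M \<Longrightarrow> dist (X m) (X n) < r / 2"
      using metric_CauchyD[OF X, of "r / 2"] by auto
    have "dist (X m) (Abs_ell2 f) < r" if m: "m \<ge> M" for m
    proof -
      have bnd: "\<And>n. n \<ge> M \<Longrightarrow> dist (X m) (X n) < r / 2" using M m by blast
      have "(norm (X m - Abs_ell2 f))\<^sup>2 = (\<Sum>i. (ell2_nth (X m) i - f i)\<^sup>2)"
        unfolding power2_norm_eq_inner inner_ell2_def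
        by (simp add: minus_ell2.rep_eq F power2_eq_square)
      also have "\<dots> \<le> (r / 2)\<^sup>2"
        using r by (intro suminf_le_const summ[OF _ bnd] part[OF _ bnd]) auto
      finally have "norm (X m - Abs_ell2 f) \<le> r / 2"
        by (rule power2_le_imp_le) (use r in simp)
      then show ?thesis using r by (simp add: dist_norm)
    qed
    then show "\<exists>no. \<forall>n\<ge>no. dist (X n) (Abs_ell2 f) < r" by blast
  qed
  then show "convergent X" by (rule convergentI)
qed


section \<open>The Haagerup property\<close>

definition isometric_action :: "('g, 'm) monoid_scheme \<Rightarrow> ('g \<Rightarrow> 'x::metric_space \<Rightarrow> 'x) \<Rightarrow> bool" where
  "isometric_action G \<phi> \<longleftrightarrow>
     group_action G UNIV \<phi> \<and> (\<forall>g\<in>carrier G. \<forall>x y. dist (\<phi> g x) (\<phi> g y) = dist x y)"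

definition metrically_proper :: "('g, 'm) monoid_scheme \<Rightarrow> ('g \<Rightarrow> 'x::metric_space \<Rightarrow> 'x) \<Rightarrow> bool" where
  "metrically_proper G \<phi> \<longleftrightarrow>
     (\<forall>B. bounded B \<longrightarrow> finite {g \<in> carrier G. \<phi> g ` B \<inter> B \<noteq> {}})"

text \<open>
  HOL cannot quantify over all Hilbert spaces inside a formula, so the Hilbert space
  on which the group acts is a type parameter. Complex Hilbert spaces are covered through their
  underlying real Hilbert spaces, which carry the same metric; isometries
  are distance-preserving maps and need not be linear.

  A countable group that has the property for some Hilbert space also has it for
  \<^typ>\<open>ell2\<close>: the closed linear span of an orbit is separable, hence embeds isometrically
  into \<^typ>\<open>ell2\<close>. So a hypothesis for an arbitrary (universally quantified) type
  and a conclusion for \<^typ>\<open>ell2\<close> both express the existence of some Hilbert space.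
\<close>

definition haagerup ::
  "'h::{real_inner,complete_space} itself \<Rightarrow> ('g, 'm) monoid_scheme \<Rightarrow> bool" where
  "haagerup (_ :: 'h itself) G \<longleftrightarrow>
     group G \<and> countable (carrier G) \<and>
     (\<exists>\<phi> :: 'g \<Rightarrow> 'h \<Rightarrow> 'h. isometric_action G \<phi> \<and> metrically_proper G \<phi>)"


section \<open>The standard wreath product\<close>

definition semidirect_product ::
  "('n, 'a) monoid_scheme \<Rightarrow> ('q, 'b) monoid_scheme \<Rightarrow> ('q \<Rightarrow> 'n \<Rightarrow> 'n) \<Rightarrow> ('n \<times> 'q) monoid" where
  "semidirect_product N Q \<theta> =
     \<lparr>carrier = carrier N \<times> carrier Q,
      mult = (\<lambda>(n, q) (n', q'). (n \<otimes>\<^bsub>N\<^esub> \<theta> q n', q \<otimes>\<^bsub>Q\<^esub> q')),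
      one = (\<one>\<^bsub>N\<^esub>, \<one>\<^bsub>Q\<^esub>)\<rparr>"

definition shift :: "('g, 'm) monoid_scheme \<Rightarrow> 'g \<Rightarrow> ('g \<Rightarrow> 'h) \<Rightarrow> 'g \<Rightarrow> 'h" where
  "shift G g w = (\<lambda>x\<in>carrier G. w (inv\<^bsub>G\<^esub> g \<otimes>\<^bsub>G\<^esub> x))"

text \<open>
  The carrier of \<^term>\<open>sum_group (carrier G) (\<lambda>_. H)\<close> consists of the finitely supported
  functions from \<^term>\<open>carrier G\<close> to \<^term>\<open>carrier H\<close>, extended by \<^term>\<open>undefined\<close>
  outside \<^term>\<open>carrier G\<close> (see \<open>carrier_sum_group\<close>).
\<close>

definition wreath_product ::
  "('h, 'a) monoid_scheme \<Rightarrow> ('g, 'b) monoid_scheme \<Rightarrow> (('g \<Rightarrow> 'h) \<times> 'g) monoid" where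
  "wreath_product H G = semidirect_product (sum_group (carrier G) (\<lambda>_. H)) G (shift G)"

lemma group_wreath_product:
  assumes "group G" "group H"
  shows "group (wreath_product H G)"
proof -
  interpret G: group G by fact
  interpret H: group H by fact
  let ?N = "sum_group (carrier G) (\<lambda>_. H)"
  interpret N: group ?N by (simp add: assms)
  note cN = carrier_sum_group[OF assms(2), of "carrier G"]
  have shift_closed: "shift G g w \<in> carrier ?N" if g: "g \<in> carrier G" and w: "w \<in> carrier ?N" for g w
  proof -
    have fin: "finite {i \<in> carrier G. w i \<noteq> \<one>\<^bsub>H\<^esub>}" and PE: "w \<in> carrier G \<rightarrow>\<^sub>E carrier H"
      using w by (auto simp: cN)
    have "{i \<in> carrier G. shift G g w i \<noteq> \<one>\<^bsub>H\<^esub>}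
        \<subseteq> (\<lambda>i. g \<otimes>\<^bsub>G\<^esub> i) ` {i \<in> carrier G. w i \<noteq> \<one>\<^bsub>H\<^esub>}"
    proof
      fix i assume i: "i \<in> {i \<in> carrier G. shift G g w i \<noteq> \<one>\<^bsub>H\<^esub>}"
      then have "i = g \<otimes>\<^bsub>G\<^esub> (inv\<^bsub>G\<^esub> g \<otimes>\<^bsub>G\<^esub> i)"
        using g by (simp add: G.m_assoc[symmetric])
      then show "i \<in> (\<lambda>i. g \<otimes>\<^bsub>G\<^esub> i) ` {i \<in> carrier G. w i \<noteq> \<one>\<^bsub>H\<^esub>}"
        using i g by (intro image_eqI[where x="inv\<^bsub>G\<^esub> g \<otimes>\<^bsub>G\<^esub> i"]) (auto simp: shift_def)
    qed
    then have "finite {i \<in> carrier G. shift G g w i \<noteq> \<one>\<^bsub>H\<^esub>}"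
      using fin by (meson finite_imageI finite_subset)
    moreover have "shift G g w \<in> carrier G \<rightarrow>\<^sub>E carrier H"
      using PE g by (auto simp: shift_def PiE_iff)
    ultimately show ?thesis by (simp add: cN)
  qed
  have shift_mult: "shift G g (v \<otimes>\<^bsub>?N\<^esub> w) = shift G g v \<otimes>\<^bsub>?N\<^esub> shift G g w"
    if "g \<in> carrier G" for g v w
    using that by (auto simp: shift_def)
  have shift_shift: "shift G g (shift G g' w) = shift G (g \<otimes>\<^bsub>G\<^esub> g') w"
    if "g \<in> carrier G" "g' \<in> carrier G" for g g' w
    using that by (auto simp: shift_def G.inv_mult_group G.m_assoc)
  have shift_one: "shift G \<one>\<^bsub>G\<^esub> w = w" if "w \<in> carrier ?N" for w
    using that by (auto simp: shift_def cN PiE_iff extensional_def)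
  show ?thesis
  proof (rule groupI)
    show "\<exists>y\<in>carrier (wreath_product H G). y \<otimes>\<^bsub>wreath_product H G\<^esub> x = \<one>\<^bsub>wreath_product H G\<^esub>"
      if xW: "x \<in> carrier (wreath_product H G)" for x
    proof -
      obtain w g where x: "x = (w, g)" "w \<in> carrier ?N" "g \<in> carrier G"
        using xW by (cases x) (auto simp: wreath_product_def semidirect_product_def)
      let ?y = "(inv\<^bsub>?N\<^esub> (shift G (inv\<^bsub>G\<^esub> g) w), inv\<^bsub>G\<^esub> g)"
      have c: "shift G (inv\<^bsub>G\<^esub> g) w \<in> carrier ?N" using x by (intro shift_closed) auto
      show ?thesis
        by (rule bexI[of _ ?y])
           (use x c N.l_inv[OF c] N.inv_closed[OF c] in
             \<open>auto simp: wreath_product_def semidirect_product_def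
               simp del: mult_sum_group one_sum_group inv_sum_group\<close>)
    qed
  next
    fix x y z
    assume "x \<in> carrier (wreath_product H G)" "y \<in> carrier (wreath_product H G)"
      "z \<in> carrier (wreath_product H G)"
    then show "x \<otimes>\<^bsub>wreath_product H G\<^esub> y \<otimes>\<^bsub>wreath_product H G\<^esub> z
        = x \<otimes>\<^bsub>wreath_product H G\<^esub> (y \<otimes>\<^bsub>wreath_product H G\<^esub> z)"
      by (auto simp: wreath_product_def semidirect_product_def shift_closed shift_mult
          shift_shift N.m_assoc G.m_assoc simp del: mult_sum_group)
  qed (auto simp: wreath_product_def semidirect_product_def shift_closed shift_one
      simp del: mult_sum_group one_sum_group)
qed

end

theory Submission
  imports Defs "HOL-Library.Poly_Mapping" "HOL-Real_Asymp.Real_Asymp"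
begin

text \<open>
  Let \<open>b : G \<rightarrow> V\<close> be the orbit map of a proper isometric action. Given \<open>\<epsilon> > 0\<close>, take the random
  circle-valued field \<open>X\<^sub>x = U \<cdot> exp (i \<langle>Z, b x\<rangle>)\<close> on \<open>G\<close>, with \<open>U\<close> uniform and \<open>Z\<close> Gaussian of
  variance proportional to \<open>\<epsilon>\<close>; its law is \<open>G\<close>-invariant. With \<open>c\<^sub>x = \<bar>1 + X\<^sub>x\<bar>\<^sup>2 / 4\<close>, the kernel
  \<open>E (c\<^sub>g\<^sup>s c\<^sub>h\<^sup>s \<Prod> c\<^sub>x)\<close> on pairs of elements \<open>(w, g)\<close>, \<open>(w', h)\<close> of the wreath product, the product
  ranging over the \<open>x\<close> with \<open>w x \<noteq> w' x\<close>, is positive definite since \<open>c\<^sub>x\<close> and \<open>1 - c\<^sub>x\<close> are both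
  absolute squares. Normalised by \<open>E (c\<^sub>g\<^sup>2\<^sup>s)\<close>, it tends to 1 pointwise as \<open>\<epsilon> \<rightarrow> 0\<close> and then
  \<open>s \<rightarrow> \<infinity>\<close>, but for fixed \<open>s\<close> and \<open>\<epsilon>\<close> it is at most \<open>7 / 8\<close> as soon as \<open>w\<close> and \<open>w'\<close> differ at a
  point far away from \<open>g\<close>. Hence a suitable series of the kernels \<open>1 - \<kappa>\<^sub>n\<close> is conditionally negative
  definite, left invariant, and controls the set where two lamp configurations differ. Adding
  \<open>\<parallel>b g - b h\<parallel>\<^sup>2\<close> and the squared distances between \<open>w x\<close> and \<open>w' x\<close> in an orbit of \<open>H\<close> yields a
  proper kernel, and such a kernel comes from a metrically proper isometric action on \<open>\<ell>\<^sup>2\<close>.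
\<close>

section \<open>Positive functionals on group rings\<close>

text \<open>Multiplying a kernel by the indicator of \<open>f i = f j\<close> splits its quadratic
  form over the fibres of \<open>f\<close>; positivity on each fibre then suffices.\<close>

lemma sum_eq_classes:
  fixes F :: "'i \<Rightarrow> 'i \<Rightarrow> 'b::comm_monoid_add"
  assumes "finite I"
  shows "(\<Sum>i\<in>I. \<Sum>j\<in>I. if f i = f j then F i j else 0) =
    (\<Sum>v\<in>f ` I. \<Sum>i\<in>{i\<in>I. f i = v}. \<Sum>j\<in>{i\<in>I. f i = v}. F i j)"
proof -
  have "(\<Sum>j\<in>I. if v = f j then F i j else 0) = (\<Sum>j\<in>{i\<in>I. f i = v}. F i j)" for v i
    using assms by (intro sum.mono_neutral_cong_right) auto
  then show ?thesis
    by (subst sum.image_gen[OF assms, of _ f]) (auto intro!: sum.cong)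
qed

definition pos_def_fun :: "('k::ab_group_add \<Rightarrow> real) \<Rightarrow> bool" where
  "pos_def_fun \<tau> \<longleftrightarrow> (\<forall>K (c :: 'k \<Rightarrow> real). finite K \<longrightarrow> 0 \<le> (\<Sum>k\<in>K. \<Sum>l\<in>K. c k * c l * \<tau> (k - l)))"

text \<open>
  A finitely supported \<open>a\<close> stands for the trigonometric polynomial with coefficients
  \<open>a\<close>, and a positive definite \<open>\<tau>\<close> for the characteristic function of a random
  character, so that \<open>state \<tau> a\<close> plays the role of the expectation of \<open>a\<close>.
  Only \<open>state \<tau> (a * star a) \<ge> 0\<close> is needed, hence no measure has to be constructed.
\<close>

definition star :: "('k::ab_group_add \<Rightarrow>\<^sub>0 real) \<Rightarrow> ('k \<Rightarrow>\<^sub>0 real)" where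
  "star a = (\<Sum>k\<in>Poly_Mapping.keys a. Poly_Mapping.single (- k) (Poly_Mapping.lookup a k))"

definition state :: "('k::ab_group_add \<Rightarrow> real) \<Rightarrow> ('k \<Rightarrow>\<^sub>0 real) \<Rightarrow> real" where
  "state \<tau> a = (\<Sum>k\<in>Poly_Mapping.keys a. Poly_Mapping.lookup a k * \<tau> k)"

lemma star_superset:
  "finite K \<Longrightarrow> Poly_Mapping.keys a \<subseteq> K \<Longrightarrow> star a = (\<Sum>k\<in>K. Poly_Mapping.single (- k) (Poly_Mapping.lookup a k))"
  unfolding star_def by (rule sum.mono_neutral_left) (auto simp: in_keys_iff)

lemma state_superset:
  "finite K \<Longrightarrow> Poly_Mapping.keys a \<subseteq> K \<Longrightarrow> state \<tau> a = (\<Sum>k\<in>K. Poly_Mapping.lookup a k * \<tau> k)"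
  unfolding state_def by (rule sum.mono_neutral_left) (auto simp: in_keys_iff)

lemma star_add: "star (a + b) = star a + star b"
proof -
  have K: "finite (Poly_Mapping.keys a \<union> Poly_Mapping.keys b)" by simp
  show ?thesis
    using star_superset[OF K] keys_add[of a b]
    by (simp add: lookup_add single_add sum.distrib)
qed

lemma state_add: "state \<tau> (a + b) = state \<tau> a + state \<tau> b"
proof -
  have K: "finite (Poly_Mapping.keys a \<union> Poly_Mapping.keys b)" by simp
  show ?thesis
    using state_superset[OF K] keys_add[of a b]
    by (simp add: lookup_add distrib_right sum.distrib)
qed

lemma star_single [simp]: "star (Poly_Mapping.single k c) = Poly_Mapping.single (- k) c"
  by (simp add: star_def)

lemma state_single [simp]: "state \<tau> (Poly_Mapping.single k c) = c * \<tau> k"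
  by (simp add: state_def)

lemma star_zero [simp]: "star 0 = 0"
  by (simp add: star_def)

lemma state_zero [simp]: "state \<tau> 0 = 0"
  by (simp add: state_def)

lemma star_one [simp]: "star 1 = 1"
  using star_single[of 0 1] by (simp del: star_single)

lemma star_sum: "star (\<Sum>i\<in>I. f i) = (\<Sum>i\<in>I. star (f i))"
  by (induction I rule: infinite_finite_induct) (auto simp: star_add)

lemma state_sum: "state \<tau> (\<Sum>i\<in>I. f i) = (\<Sum>i\<in>I. state \<tau> (f i))"
  by (induction I rule: infinite_finite_induct) (auto simp: state_add)

lemma state_diff: "state \<tau> (a - b) = state \<tau> a - state \<tau> b"
  using state_add[of \<tau> "a - b" b] by simp

lemma star_diff: "star (a - b) = star a - star b"
  using star_add[of "a - b" b] by (simp add: algebra_simps)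

lemma poly_mapping_sum_single: "a = (\<Sum>k\<in>Poly_Mapping.keys a. Poly_Mapping.single k (Poly_Mapping.lookup a k))"
  by (rule poly_mapping_eqI) (auto simp: lookup_sum lookup_single when_def in_keys_iff)

lemma star_mult: "star (a * b) = star a * star (b :: 'k::ab_group_add \<Rightarrow>\<^sub>0 real)"
proof -
  let ?s = "\<lambda>k l. Poly_Mapping.single (k + l) (Poly_Mapping.lookup a k * Poly_Mapping.lookup b l)"
  have "a * b = (\<Sum>k\<in>Poly_Mapping.keys a. \<Sum>l\<in>Poly_Mapping.keys b. ?s k l)"
    by (subst (1) poly_mapping_sum_single[of a], subst (1) poly_mapping_sum_single[of b])
      (simp add: sum_product mult_single)
  then have "star (a * b) = (\<Sum>k\<in>Poly_Mapping.keys a. \<Sum>l\<in>Poly_Mapping.keys b. star (?s k l))"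
    by (simp only: star_sum)
  also have "\<dots> = star a * star b"
    by (simp add: star_def[of a] star_def[of b] sum_product mult_single)
  finally show ?thesis .
qed

lemma star_prod: "star (\<Prod>i\<in>I. f i) = (\<Prod>i\<in>I. star (f i))"
  by (induction I rule: infinite_finite_induct) (auto simp: star_mult)

lemma star_power: "star (a ^ n) = star a ^ n"
  by (induction n) (auto simp: star_mult)

lemma star_star [simp]: "star (star a) = a"
  by (simp add: star_def[of a] star_sum flip: poly_mapping_sum_single)

lemma state_single_mult: "state \<tau> (Poly_Mapping.single 0 c * a) = c * state \<tau> a"
proof -
  have "Poly_Mapping.single 0 c * a = (\<Sum>k\<in>Poly_Mapping.keys a. Poly_Mapping.single k (c * Poly_Mapping.lookup a k))"
    by (subst (1) poly_mapping_sum_single[of a]) (simp add: sum_distrib_left mult_single)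
  then show ?thesis by (simp add: state_sum state_def[of \<tau> a] sum_distrib_left mult_ac)
qed

lemma state_mult_star:
  "state \<tau> ((\<Sum>i\<in>I. Poly_Mapping.single (k i) (c i)) * star (\<Sum>i\<in>I. Poly_Mapping.single (k i) (c i))) =
    (\<Sum>i\<in>I. \<Sum>j\<in>I. c i * c j * \<tau> (k i - k j))"
  by (simp add: star_sum sum_product mult_single state_sum)

lemma state_mult_star_nonneg:
  assumes "pos_def_fun \<tau>"
  shows "0 \<le> state \<tau> (a * star a)"
proof -
  have "state \<tau> (a * star a) = (\<Sum>k\<in>Poly_Mapping.keys a. \<Sum>l\<in>Poly_Mapping.keys a. Poly_Mapping.lookup a k * Poly_Mapping.lookup a l * \<tau> (k - l))"
    using state_mult_star[of \<tau> "\<lambda>k. k" "Poly_Mapping.lookup a" "Poly_Mapping.keys a"]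
    by (simp flip: poly_mapping_sum_single)
  then show ?thesis using assms by (simp add: pos_def_fun_def)
qed

text \<open>
  If the random character takes the value \<open>cis t\<close> at \<open>k\<close>, then \<open>cos_sq k\<close> stands for
  \<open>(cos (t / 2))\<^sup>2\<close>.
\<close>

definition half_sum :: "'k::ab_group_add \<Rightarrow> 'k \<Rightarrow>\<^sub>0 real" where
  "half_sum k = Poly_Mapping.single 0 (1 / 2) + Poly_Mapping.single k (1 / 2)"

definition half_diff :: "'k::ab_group_add \<Rightarrow> 'k \<Rightarrow>\<^sub>0 real" where
  "half_diff k = Poly_Mapping.single 0 (1 / 2) + Poly_Mapping.single k (- 1 / 2)"

definition cos_sq :: "'k::ab_group_add \<Rightarrow> 'k \<Rightarrow>\<^sub>0 real" where
  "cos_sq k = half_sum k * star (half_sum k)"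

text \<open>The identity \<open>|1 + z|^2 + |1 - z|^2 = 4\<close> on the unit circle, with
  \<open>|z| = 1\<close> replaced by the product of the monomials at \<open>k\<close> and
  \<open>- k\<close> being 1.\<close>

lemma one_minus_cos_sq: "1 - cos_sq k = half_diff k * star (half_diff k)"
proof -
  let ?s = "\<lambda>k. Poly_Mapping.single k (1 / 2 :: real)"
  have sq: "?s 0 * ?s 0 = Poly_Mapping.single 0 (1 / 4)" "?s k * ?s (- k) = Poly_Mapping.single 0 (1 / 4)"
    by (simp_all add: mult_single)
  have "half_diff k = ?s 0 - ?s k"
    by (simp add: half_diff_def single_uminus[symmetric] flip: diff_conv_add_uminus)
  then have "cos_sq k + half_diff k * star (half_diff k)
      = (?s 0 + ?s k) * (?s 0 + ?s (- k)) + (?s 0 - ?s k) * (?s 0 - ?s (- k))"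
    by (simp add: cos_sq_def half_sum_def star_add star_diff)
  also have "\<dots> = 2 * (?s 0 * ?s 0) + 2 * (?s k * ?s (- k))"
    by (simp add: algebra_simps)
  also have "\<dots> = 4 * Poly_Mapping.single 0 (1 / 4)"
    unfolding sq by simp
  also have "\<dots> = Poly_Mapping.single 0 4 * Poly_Mapping.single 0 (1 / 4)"
    by simp
  also have "\<dots> = 1"
    by (simp add: mult_single del: single_numeral)
  finally show ?thesis by (simp add: algebra_simps)
qed

lemma star_cos_sq: "star (cos_sq k) = cos_sq k"
  by (simp add: cos_sq_def star_mult mult.commute)

section \<open>Products of the factors \<open>cos_sq\<close>\<close>

lemma prod_cos_sq:
  "(\<Prod>i\<in>I. cos_sq (k i)) = (\<Prod>i\<in>I. half_sum (k i)) * star (\<Prod>i\<in>I. half_sum (k i))"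
  by (simp add: cos_sq_def prod.distrib star_prod)

lemma prod_single:
  fixes c :: "'i \<Rightarrow> 'r::comm_semiring_1"
  shows "(\<Prod>i\<in>A. Poly_Mapping.single (k i) (c i)) = Poly_Mapping.single (\<Sum>i\<in>A. k i :: 'k::comm_monoid_add) (\<Prod>i\<in>A. c i)"
  by (induction A rule: infinite_finite_induct) (auto simp: mult_single)

lemma prod_half_sum:
  assumes "finite I"
  shows "(\<Prod>i\<in>I. half_sum (k i)) = (\<Sum>A\<in>Pow I. Poly_Mapping.single (\<Sum>i\<in>A. k i) ((1 / 2) ^ card I))"
proof -
  have "(\<Prod>i\<in>I. half_sum (k i)) =
    (\<Sum>A\<in>Pow I. (\<Prod>i\<in>A. Poly_Mapping.single (k i) (1 / 2)) * (\<Prod>i\<in>I - A. Poly_Mapping.single 0 (1 / 2)))"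
    unfolding half_sum_def add.commute[of "Poly_Mapping.single 0 _"] by (rule prod_add[OF assms])
  also have "\<dots> = (\<Sum>A\<in>Pow I. Poly_Mapping.single (\<Sum>i\<in>A. k i) ((1 / 2) ^ card I))"
  proof (rule sum.cong[OF refl])
    fix A assume "A \<in> Pow I"
    then have "card A + card (I - A) = card I" "finite A"
      using assms by (auto simp: card_Diff_subset card_mono finite_subset)
    then show "(\<Prod>i\<in>A. Poly_Mapping.single (k i) (1 / 2)) * (\<Prod>i\<in>I - A. Poly_Mapping.single 0 (1 / 2))
      = Poly_Mapping.single (\<Sum>i\<in>A. k i) ((1 / 2 :: real) ^ card I)"
      unfolding prod_single mult_single by (simp flip: power_add)
  qed
  finally show ?thesis .
qed

text \<open>There are \<open>4 ^ card I\<close> pairs of subsets, so the state is an average of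
  values of \<open>\<tau>\<close>.\<close>

lemma state_prod_cos_sq:
  assumes "finite I"
  shows "state \<tau> (\<Prod>i\<in>I. cos_sq (k i)) =
    (\<Sum>A\<in>Pow I. \<Sum>B\<in>Pow I. \<tau> ((\<Sum>i\<in>A. k i) - (\<Sum>i\<in>B. k i))) / 4 ^ card I"
proof -
  have "(1 / 2 :: real) ^ n * (1 / 2) ^ n = 1 / 4 ^ n" for n
    by (simp add: power_mult_distrib[symmetric] power_one_over)
  then show ?thesis
    using assms by (simp add: prod_cos_sq prod_half_sum state_mult_star sum_divide_distrib)
qed

text \<open>Each factor loses the state of \<open>a * star a * (1 - cos_sq (k x))\<close>, a
  Hermitian square. Absorbing \<open>half_sum (k x)\<close> into \<open>a\<close> preserves the
  shape, hence the induction over arbitrary \<open>a\<close>.\<close>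

lemma state_mult_prod_cos_sq_le:
  assumes \<tau>: "pos_def_fun \<tau>" and "finite D"
  shows "state \<tau> (a * star a * (\<Prod>x\<in>D. cos_sq (k x))) \<le> state \<tau> (a * star a)"
  using \<open>finite D\<close>
proof (induction D arbitrary: a rule: finite_induct)
  case empty
  then show ?case by simp
next
  case (insert x D)
  let ?a = "a * half_sum (k x)" and ?b = "a * half_diff (k x)"
  have "a * star a * (\<Prod>x\<in>insert x D. cos_sq (k x)) = ?a * star ?a * (\<Prod>x\<in>D. cos_sq (k x))"
    using insert.hyps by (simp add: cos_sq_def star_mult mult_ac)
  also have "state \<tau> \<dots> \<le> state \<tau> (?a * star ?a)" by (rule insert.IH)
  also have "?a * star ?a = a * star a - ?b * star ?b"
  proof -
    have "?a * star ?a = a * star a * cos_sq (k x)" "?b * star ?b = a * star a * (1 - cos_sq (k x))"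
      unfolding one_minus_cos_sq by (simp_all add: cos_sq_def star_mult mult_ac)
    then show ?thesis by (simp add: right_diff_distrib)
  qed
  also have "state \<tau> \<dots> \<le> state \<tau> (a * star a)"
    using state_mult_star_nonneg[OF \<tau>, of ?b] by (simp add: state_diff)
  finally show ?case .
qed

text \<open>
  Writing the factor at \<open>x\<close> as \<open>cos_sq (k x) + (if w i x = w j x then 1 - cos_sq (k x) else 0)\<close>
  for every \<open>x \<in> S\<close> and expanding, each summand is a Hermitian square times the indicator of
  \<open>w i = w j\<close> on a subset of \<open>S\<close>.
\<close>

lemma state_kernel_nonneg:
  fixes u :: "nat \<Rightarrow> 'k::ab_group_add \<Rightarrow>\<^sub>0 real" and w :: "nat \<Rightarrow> 'x \<Rightarrow> 'h" and r :: "nat \<Rightarrow> real"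
  assumes \<tau>: "pos_def_fun \<tau>" and u: "\<And>i. star (u i) = u i" and S: "finite S"
  shows "0 \<le> (\<Sum>i<n. \<Sum>j<n. r i * r j * state \<tau> (u i * u j * (\<Prod>x\<in>{x\<in>S. w i x \<noteq> w j x}. cos_sq (k x))))"
proof -
  define X where "X i = Poly_Mapping.single 0 (r i) * u i" for i
  define q where "q T = (\<Prod>x\<in>T. half_sum (k x)) * (\<Prod>x\<in>S - T. half_diff (k x))" for T
  \<comment> \<open>Agreement of \<open>w i\<close> and \<open>w j\<close> on \<open>S - T\<close>
    becomes equality of two restrictions, the form that \<open>sum_eq_classes\<close>
    handles.\<close>
  define res where "res T i = restrict (w i) (S - T)" for T i
  have star_X: "star (X i) = X i" for i by (simp add: X_def star_mult u)
  have prod_eq: "(\<Prod>x\<in>{x\<in>S. w i x \<noteq> w j x}. cos_sq (k x)) =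
    (\<Sum>T\<in>Pow S. if res T i = res T j then q T * star (q T) else 0)" for i j
  proof -
    have "(\<Prod>x\<in>{x\<in>S. w i x \<noteq> w j x}. cos_sq (k x))
        = (\<Prod>x\<in>S. cos_sq (k x) + (if w i x = w j x then 1 - cos_sq (k x) else 0))"
      using S by (intro prod.mono_neutral_cong_left) auto
    also have "\<dots> = (\<Sum>T\<in>Pow S. (\<Prod>x\<in>T. cos_sq (k x)) *
        (\<Prod>x\<in>S - T. if w i x = w j x then 1 - cos_sq (k x) else 0))"
      by (rule prod_add[OF S])
    also have "\<dots> = (\<Sum>T\<in>Pow S. if res T i = res T j then q T * star (q T) else 0)"
    proof (rule sum.cong[OF refl])
      fix T assume "T \<in> Pow S"
      show "(\<Prod>x\<in>T. cos_sq (k x)) * (\<Prod>x\<in>S - T. if w i x = w j x then 1 - cos_sq (k x) else 0)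
        = (if res T i = res T j then q T * star (q T) else 0)"
      proof (cases "res T i = res T j")
        case True
        then have "\<forall>x\<in>S - T. w i x = w j x" unfolding res_def by (metis restrict_apply')
        then have "(\<Prod>x\<in>S - T. if w i x = w j x then 1 - cos_sq (k x) else 0)
            = (\<Prod>x\<in>S - T. half_diff (k x) * star (half_diff (k x)))"
          by (intro prod.cong) (auto simp: one_minus_cos_sq)
        with True show ?thesis
          by (simp add: q_def prod_cos_sq prod.distrib star_mult star_prod mult_ac)
      next
        case False
        then obtain x where "x \<in> S - T" "w i x \<noteq> w j x" unfolding res_def by fastforce
        then have "(\<Prod>x\<in>S - T. if w i x = w j x then 1 - cos_sq (k x) else 0) = 0"
          using S by (intro prod_zero) auto
        with False show ?thesis by simp
      qed
    qed
    finally show ?thesis .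
  qed
  have "(\<Sum>i<n. \<Sum>j<n. r i * r j * state \<tau> (u i * u j * (\<Prod>x\<in>{x\<in>S. w i x \<noteq> w j x}. cos_sq (k x))))
    = (\<Sum>i<n. \<Sum>j<n. state \<tau> (X i * X j * (\<Prod>x\<in>{x\<in>S. w i x \<noteq> w j x}. cos_sq (k x))))"
    by (intro sum.cong refl) (simp add: X_def mult_single mult_ac flip: state_single_mult)
  also have "\<dots> = (\<Sum>i<n. \<Sum>j<n. \<Sum>T\<in>Pow S. if res T i = res T j then state \<tau> (X i * X j * (q T * star (q T))) else 0)"
    unfolding prod_eq by (simp add: sum_distrib_left state_sum if_distrib cong: if_cong)
  also have "\<dots> = (\<Sum>i<n. \<Sum>T\<in>Pow S. \<Sum>j<n. if res T i = res T j then state \<tau> (X i * X j * (q T * star (q T))) else 0)"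
    by (intro sum.cong refl sum.swap)
  also have "\<dots> = (\<Sum>T\<in>Pow S. \<Sum>i<n. \<Sum>j<n. if res T i = res T j then state \<tau> (X i * X j * (q T * star (q T))) else 0)"
    by (rule sum.swap)
  also have "\<dots> \<ge> 0"
  proof (rule sum_nonneg)
    fix T
    have "0 \<le> (\<Sum>i\<in>I. \<Sum>j\<in>I. state \<tau> (X i * X j * (q T * star (q T))))" for I
    proof -
      have "(\<Sum>i\<in>I. X i) * q T * star ((\<Sum>i\<in>I. X i) * q T)
        = (\<Sum>i\<in>I. \<Sum>j\<in>I. X i * X j) * (q T * star (q T))"
        by (simp only: star_mult star_sum star_X sum_product[symmetric] mult_ac)
      then have "(\<Sum>i\<in>I. \<Sum>j\<in>I. state \<tau> (X i * X j * (q T * star (q T))))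
        = state \<tau> ((\<Sum>i\<in>I. X i) * q T * star ((\<Sum>i\<in>I. X i) * q T))"
        by (simp add: state_sum[symmetric] sum_distrib_right)
      then show ?thesis using state_mult_star_nonneg[OF \<tau>] by simp
    qed
    then show "0 \<le> (\<Sum>i<n. \<Sum>j<n. if res T i = res T j then state \<tau> (X i * X j * (q T * star (q T))) else 0)"
      by (simp add: sum_eq_classes sum_nonneg)
  qed
  finally show ?thesis .
qed

section \<open>Gaussian moments\<close>

text \<open>Both sides are linear in \<open>x\<close>, and for \<open>x\<close> in \<open>C\<close>
  orthogonality leaves one term. The basis is not normalised; a zero vector in \<open>C\<close>
  contributes 0.\<close>

lemma inner_orthogonal_expansion:
  fixes C :: "'v::real_inner set"
  assumes "finite C" "pairwise orthogonal C" "x \<in> span C"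
  shows "inner x y = (\<Sum>e\<in>C. inner x e * inner y e / inner e e)"
  using assms(3)
proof (induction rule: span_induct)
  case base
  show ?case
    by (rule subspaceI)
      (simp_all add: inner_add_left distrib_right add_divide_distrib sum.distrib sum_distrib_left mult.assoc)
next
  case (step x)
  have "(\<Sum>e\<in>C. inner x e * inner y e / inner e e) = (\<Sum>e\<in>{x}. inner x e * inner y e / inner e e)"
    using assms(1,2) step by (intro sum.mono_neutral_right) (auto simp: pairwise_def orthogonal_def)
  then show ?case by (simp add: inner_commute)
qed

text \<open>Schur's product argument: one factor is expanded in an orthogonal basis, and each basis
  vector \<open>e\<close> reweights \<open>c i\<close> by \<open>inner (v i) e\<close>.\<close>

lemma inner_power_nonneg:
  fixes v :: "'i \<Rightarrow> 'v::real_inner"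
  assumes "finite I"
  shows "0 \<le> (\<Sum>i\<in>I. \<Sum>j\<in>I. c i * c j * inner (v i) (v j) ^ n)"
proof (induction n arbitrary: c)
  case 0
  have "(\<Sum>i\<in>I. \<Sum>j\<in>I. c i * c j) = (\<Sum>i\<in>I. c i)\<^sup>2"
    by (simp add: power2_eq_square sum_product)
  then show ?case by simp
next
  case (Suc n)
  obtain C where C: "finite C" "span C = span (v ` I)" "pairwise orthogonal C"
    using basis_orthogonal[of "v ` I"] assms by auto
  have expand: "inner (v i) (v j) = (\<Sum>e\<in>C. inner (v i) e * inner (v j) e / inner e e)" if "i \<in> I" for i j
    using C that by (intro inner_orthogonal_expansion) (auto intro: span_base)
  have "(\<Sum>i\<in>I. \<Sum>j\<in>I. c i * c j * inner (v i) (v j) ^ Suc n)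
    = (\<Sum>i\<in>I. \<Sum>j\<in>I. \<Sum>e\<in>C. (c i * inner (v i) e) * (c j * inner (v j) e) * inner (v i) (v j) ^ n / inner e e)"
  proof (intro sum.cong refl)
    fix i j assume "i \<in> I"
    have "c i * c j * inner (v i) (v j) ^ Suc n = (c i * c j * inner (v i) (v j) ^ n) * inner (v i) (v j)"
      by simp
    also have "\<dots> = (c i * c j * inner (v i) (v j) ^ n) * (\<Sum>e\<in>C. inner (v i) e * inner (v j) e / inner e e)"
      by (subst (2) expand[OF \<open>i \<in> I\<close>]) (rule refl)
    finally show "c i * c j * inner (v i) (v j) ^ Suc n =
      (\<Sum>e\<in>C. (c i * inner (v i) e) * (c j * inner (v j) e) * inner (v i) (v j) ^ n / inner e e)"
      by (simp add: sum_distrib_left mult_ac)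
  qed
  also have "\<dots> = (\<Sum>i\<in>I. \<Sum>e\<in>C. \<Sum>j\<in>I. (c i * inner (v i) e) * (c j * inner (v j) e) * inner (v i) (v j) ^ n / inner e e)"
    by (intro sum.cong refl sum.swap)
  also have "\<dots> = (\<Sum>e\<in>C. \<Sum>i\<in>I. \<Sum>j\<in>I. (c i * inner (v i) e) * (c j * inner (v j) e) * inner (v i) (v j) ^ n / inner e e)"
    by (rule sum.swap)
  also have "\<dots> = (\<Sum>e\<in>C. (\<Sum>i\<in>I. \<Sum>j\<in>I. (c i * inner (v i) e) * (c j * inner (v j) e) * inner (v i) (v j) ^ n) / inner e e)"
    by (simp only: sum_divide_distrib)
  also have "\<dots> \<ge> 0"
    by (rule sum_nonneg, rule divide_nonneg_nonneg[OF Suc.IH]) simp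
  finally show ?case .
qed

lemma exp_inner_nonneg:
  fixes v :: "'i \<Rightarrow> 'v::real_inner"
  assumes "finite I" "0 \<le> t"
  shows "0 \<le> (\<Sum>i\<in>I. \<Sum>j\<in>I. c i * c j * exp (t * inner (v i) (v j)))"
proof (rule sums_le[OF _ sums_zero])
  show "(\<lambda>n. \<Sum>i\<in>I. \<Sum>j\<in>I. c i * c j * ((t * inner (v i) (v j)) ^ n /\<^sub>R fact n)) sums
    (\<Sum>i\<in>I. \<Sum>j\<in>I. c i * c j * exp (t * inner (v i) (v j)))"
    by (intro sums_sum sums_mult exp_converges)
  fix n
  have "(\<Sum>i\<in>I. \<Sum>j\<in>I. c i * c j * ((t * inner (v i) (v j)) ^ n /\<^sub>R fact n))
    = (t ^ n / fact n) * (\<Sum>i\<in>I. \<Sum>j\<in>I. c i * c j * inner (v i) (v j) ^ n)"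
    by (simp add: sum_distrib_left power_mult_distrib field_simps)
  moreover have "0 \<le> (t ^ n / fact n) * (\<Sum>i\<in>I. \<Sum>j\<in>I. c i * c j * inner (v i) (v j) ^ n)"
    using assms by (intro mult_nonneg_nonneg inner_power_nonneg) auto
  ultimately show "0 \<le> (\<Sum>i\<in>I. \<Sum>j\<in>I. c i * c j * ((t * inner (v i) (v j)) ^ n /\<^sub>R fact n))"
    by (simp only:)
qed

text \<open>
  The characteristic function of \<open>(U, Z)\<close>, with \<open>U\<close> uniform on the circle and \<open>Z\<close> a Gaussian
  process over the Hilbert space, independent of \<open>U\<close>. Thanks to \<open>U\<close> the field \<open>x \<mapsto> (1, b x)\<close>
  depends on the distances between the points \<open>b x\<close> only, not on the choice of an origin.
\<close>

definition gauss :: "real \<Rightarrow> int \<times> 'v::real_inner \<Rightarrow> real" where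
  "gauss \<epsilon> k = (if fst k = 0 then exp (- (\<epsilon> * (norm (snd k))\<^sup>2)) else 0)"

text \<open>Expanding the squared norm leaves one weight per point, absorbed into \<open>d\<close>,
  and the kernel of \<open>exp_inner_nonneg\<close>. The integer component contributes an indicator
  of equality.\<close>

lemma pos_def_fun_gauss:
  assumes "0 \<le> \<epsilon>"
  shows "pos_def_fun (gauss \<epsilon> :: int \<times> 'v::real_inner \<Rightarrow> real)"
  unfolding pos_def_fun_def
proof (intro allI impI)
  fix K :: "(int \<times> 'v) set" and c :: "int \<times> 'v \<Rightarrow> real"
  assume K: "finite K"
  define d where "d k = c k * exp (- (\<epsilon> * (norm (snd k))\<^sup>2))" for k
  let ?E = "\<lambda>k l. d k * d l * exp (2 * \<epsilon> * inner (snd k) (snd l))"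
  have exp_eq: "exp (- (\<epsilon> * (norm (x - y))\<^sup>2))
      = exp (- (\<epsilon> * (norm x)\<^sup>2)) * exp (- (\<epsilon> * (norm y)\<^sup>2)) * exp (2 * \<epsilon> * inner x y)" for x y :: 'v
    by (simp add: power2_norm_eq_inner inner_diff_left inner_diff_right inner_commute
        algebra_simps flip: exp_add)
  have "(\<Sum>k\<in>K. \<Sum>l\<in>K. c k * c l * gauss \<epsilon> (k - l)) = (\<Sum>k\<in>K. \<Sum>l\<in>K. if fst k = fst l then ?E k l else 0)"
    by (intro sum.cong refl) (simp add: gauss_def d_def exp_eq)
  also have "\<dots> = (\<Sum>m\<in>fst ` K. \<Sum>k\<in>{k\<in>K. fst k = m}. \<Sum>l\<in>{k\<in>K. fst k = m}. ?E k l)"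
    by (rule sum_eq_classes[OF K])
  also have "\<dots> \<ge> 0"
    using K assms by (intro sum_nonneg exp_inner_nonneg) auto
  finally show "0 \<le> (\<Sum>k\<in>K. \<Sum>l\<in>K. c k * c l * gauss \<epsilon> (k - l))" .
qed

section \<open>Central binomial ratios\<close>

text \<open>The mean of \<open>cos (t / 2) ^ (2 * m)\<close> over the circle.\<close>

definition central_ratio :: "nat \<Rightarrow> real" where
  "central_ratio m = real (2 * m choose m) / 4 ^ m"

lemma central_ratio_pos: "0 < central_ratio m"
  by (simp add: central_ratio_def)

lemma central_ratio_Suc: "central_ratio (Suc m) = central_ratio m * (1 - 1 / (2 * real m + 2))"
proof -
  have "Suc m * (2 * Suc m choose Suc m) = 2 * (Suc m * (2 * m + 1 choose m))"
    using Suc_times_binomial_eq[of "2 * m + 1" m] by (simp add: mult_ac)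
  also have "Suc m * (2 * m + 1 choose m) = (2 * m + 1) * (2 * m choose m)"
    using binomial_symmetric[of m "2 * m + 1"] Suc_times_binomial_eq[of "2 * m" m] by simp
  finally have "real (Suc m * (2 * Suc m choose Suc m)) = real (2 * ((2 * m + 1) * (2 * m choose m)))"
    by (simp only:)
  then have "real (Suc m) * (2 * Suc m choose Suc m) = 2 * (2 * real m + 1) * (2 * m choose m)"
    by (simp only: of_nat_mult of_nat_add of_nat_numeral of_nat_1 mult.assoc)
  moreover have "X / (4 * P) = Z / P * (1 - 1 / (2 * M + 2))"
    if "(1 + M) * X = 2 * (2 * M + 1) * Z" "0 \<le> M" "0 < P" for X Z M P :: real
  proof -
    have X: "X = 2 * (2 * M + 1) * Z / (1 + M)" using that by (simp add: field_simps)
    have M: "1 - 1 / (2 * M + 2) = (2 * M + 1) / (2 * (1 + M))" using that by (simp add: field_simps)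
    have "2 * N * Z / K / (4 * P) = Z / P * (N / (2 * K))" for N K
      by (simp add: field_simps)
    then show ?thesis unfolding X M by this
  qed
  ultimately show ?thesis unfolding central_ratio_def power_Suc by simp
qed

lemma central_ratio_add_le: "central_ratio (m + d) \<le> central_ratio m"
proof (induction d)
  case (Suc d)
  have "central_ratio (m + Suc d) \<le> central_ratio (m + d)"
    using central_ratio_pos[of "m + d"] by (simp add: central_ratio_Suc mult_left_le)
  with Suc show ?case by simp
qed simp

text \<open>Each step loses at most \<open>central_ratio m / (2 * real m + 2)\<close>. Thus
  \<open>d\<close> further factors cost little once \<open>m\<close> is large compared with
  \<open>d\<close>.\<close>

lemma central_ratio_add_ge:
  "central_ratio m * (1 - real d / (2 * real m + 2)) \<le> central_ratio (m + d)"
proof (induction d)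
  case (Suc d)
  have "central_ratio (m + d) / (2 * real (m + d) + 2) \<le> central_ratio m / (2 * real m + 2)"
    using central_ratio_add_le central_ratio_pos by (intro frac_le) (auto intro: less_imp_le)
  then have "central_ratio (m + d) - central_ratio m / (2 * real m + 2) \<le> central_ratio (m + Suc d)"
    by (simp add: central_ratio_Suc right_diff_distrib)
  moreover have "central_ratio m * (1 - real (Suc d) / M) = central_ratio m * (1 - real d / M) - central_ratio m / M" for M
    by (simp add: add_divide_distrib right_diff_distrib distrib_left)
  ultimately show ?case using Suc by (smt (verit))
qed simp

text \<open>Vandermonde: there are \<open>(N choose k)^2\<close> pairs of subsets of size
  \<open>k\<close>.\<close>

lemma sum_card_eq:
  assumes "finite I"
  shows "(\<Sum>A\<in>Pow I. \<Sum>B\<in>Pow I. if card A = card B then 1 else 0 :: real) = real (2 * card I choose card I)"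
proof -
  let ?N = "card I"
  have inner: "(\<Sum>B\<in>Pow I. if card A = card B then 1 else 0 :: real) = real (?N choose card A)" for A
  proof -
    have "(\<Sum>B\<in>Pow I. if card A = card B then 1 else 0 :: real) = real (card {B. B \<subseteq> I \<and> card B = card A})"
      using assms by (simp add: sum.If_cases Int_def eq_commute)
    then show ?thesis using n_subsets[OF assms] by simp
  qed
  have "(\<Sum>A\<in>Pow I. real (?N choose card A)) = (\<Sum>k\<le>?N. \<Sum>A\<in>{A\<in>Pow I. card A = k}. real (?N choose card A))"
    by (rule sum.group[symmetric]) (use assms in \<open>auto intro: card_mono\<close>)
  also have "\<dots> = (\<Sum>k\<le>?N. real (card {A. A \<subseteq> I \<and> card A = k}) * real (?N choose k))"
    by (intro sum.cong refl) simp
  also have "\<dots> = (\<Sum>k\<le>?N. real ((?N choose k)\<^sup>2))"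
    by (simp add: n_subsets[OF assms] power2_eq_square)
  also have "\<dots> = real (2 * ?N choose ?N)"
    by (simp only: choose_square_sum flip: of_nat_sum)
  finally show ?thesis by (simp add: inner)
qed

section \<open>Dependence of the moments on mutual distances only\<close>

text \<open>With total weight zero the terms in \<open>norm (y i)\<close> alone cancel, so the
  origin drops out.\<close>

lemma norm_sum_zero_weights:
  fixes y :: "'i \<Rightarrow> 'v::real_inner"
  assumes "sum c I = (0::real)"
  shows "(norm (\<Sum>i\<in>I. c i *\<^sub>R y i))\<^sup>2 = - (\<Sum>i\<in>I. \<Sum>j\<in>I. c i * c j * (norm (y i - y j))\<^sup>2) / 2"
proof -
  let ?q = "\<Sum>i\<in>I. c i * (norm (y i))\<^sup>2" and ?n = "\<Sum>i\<in>I. \<Sum>j\<in>I. c i * c j * inner (y i) (y j)"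
  have n: "(norm (\<Sum>i\<in>I. c i *\<^sub>R y i))\<^sup>2 = ?n"
    unfolding power2_norm_eq_inner by (simp add: inner_sum_left inner_sum_right sum_distrib_left inner_commute mult_ac)
  have "(\<Sum>i\<in>I. \<Sum>j\<in>I. c i * c j * (norm (y i - y j))\<^sup>2)
    = (\<Sum>i\<in>I. \<Sum>j\<in>I. (c i * (norm (y i))\<^sup>2) * c j + c i * (c j * (norm (y j))\<^sup>2) - 2 * (c i * c j * inner (y i) (y j)))"
    by (intro sum.cong refl)
      (simp add: power2_norm_eq_inner inner_diff_left inner_diff_right inner_commute algebra_simps)
  also have "\<dots> = ?q * sum c I + sum c I * ?q - 2 * ?n"
    by (simp only: sum.distrib sum_subtractf flip: sum_distrib_left sum_distrib_right)
  finally show ?thesis by (simp add: assms n)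
qed

text \<open>The indicator of \<open>A\<close> minus that of \<open>B\<close> has total weight zero,
  so mutual distances determine the norm.\<close>

lemma norm_sum_diff_cong:
  fixes y :: "'i \<Rightarrow> 'v::real_inner" and y' :: "'i \<Rightarrow> 'w::real_inner"
  assumes "finite I" "A \<subseteq> I" "B \<subseteq> I" "card A = card B"
    and dist: "\<And>i j. i \<in> I \<Longrightarrow> j \<in> I \<Longrightarrow> norm (y' i - y' j) = norm (y i - y j)"
  shows "norm (sum y' A - sum y' B) = norm (sum y A - sum y B)"
proof -
  define c :: "'i \<Rightarrow> real" where "c i = of_bool (i \<in> A) - of_bool (i \<in> B)" for i
  have fin: "finite A" "finite B" using assms(1-3) by (auto intro: finite_subset)
  have ind: "(\<Sum>i\<in>I. of_bool (i \<in> X) *\<^sub>R z i) = sum z X" if "X \<subseteq> I" for X and z :: "'i \<Rightarrow> 'x::real_vector"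
    using assms(1) that by (intro sum.mono_neutral_cong_right) auto
  \<comment> \<open>Polymorphic in \<open>z\<close>: it serves \<open>y\<close>, \<open>y'\<close>
    and the constant 1, the last giving total weight zero.\<close>
  have c: "(\<Sum>i\<in>I. c i *\<^sub>R z i) = sum z A - sum z B" for z :: "'i \<Rightarrow> 'x::real_vector"
    using assms by (simp add: c_def scaleR_diff_left sum_subtractf ind)
  have "sum c I = 0" using c[of "\<lambda>_. 1 :: real"] assms(4) by simp
  then have "(norm (\<Sum>i\<in>I. c i *\<^sub>R y' i))\<^sup>2 = (norm (\<Sum>i\<in>I. c i *\<^sub>R y i))\<^sup>2"
    by (simp add: norm_sum_zero_weights dist cong: sum.cong)
  then show ?thesis by (simp add: c)
qed

text \<open>The integer component of the difference of keys is \<open>card A - card B\<close>, so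
  \<open>gauss\<close> vanishes unless the sizes agree.\<close>

lemma state_gauss_prod_cos_sq:
  fixes y :: "'i \<Rightarrow> 'v::real_inner"
  assumes "finite I"
  shows "state (gauss \<epsilon>) (\<Prod>i\<in>I. cos_sq (1, y i)) =
    (\<Sum>A\<in>Pow I. \<Sum>B\<in>Pow I. if card A = card B then exp (- (\<epsilon> * (norm (sum y A - sum y B))\<^sup>2)) else 0) / 4 ^ card I"
  unfolding state_prod_cos_sq[OF assms] gauss_def
  by (simp add: fst_sum snd_sum cong: if_cong)

lemma state_gauss_prod_cos_sq_cong:
  fixes y :: "'i \<Rightarrow> 'v::real_inner" and y' :: "'i \<Rightarrow> 'w::real_inner"
  assumes "finite I" "\<And>i j. i \<in> I \<Longrightarrow> j \<in> I \<Longrightarrow> norm (y' i - y' j) = norm (y i - y j)"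
  shows "state (gauss \<epsilon>) (\<Prod>i\<in>I. cos_sq (1, y' i)) = state (gauss \<epsilon>) (\<Prod>i\<in>I. cos_sq (1, y i))"
  unfolding state_gauss_prod_cos_sq[OF assms(1)]
  by (intro arg_cong2[of _ _ _ _ "(/)"] refl sum.cong if_cong)
    (use norm_sum_diff_cong[OF assms(1) _ _ _ assms(2)] in auto)

lemma state_gauss_prod_cos_sq_const:
  assumes "finite I"
  shows "state (gauss \<epsilon>) (\<Prod>i\<in>I. cos_sq (1, v :: 'v::real_inner)) = central_ratio (card I)"
proof -
  have "(\<Sum>A\<in>Pow I. \<Sum>B\<in>Pow I. if card A = card B
      then exp (- (\<epsilon> * (norm ((\<Sum>i\<in>A. v) - (\<Sum>i\<in>B. v)))\<^sup>2)) else 0)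
    = (\<Sum>A\<in>Pow I. \<Sum>B\<in>Pow I. if card A = card B then 1 else 0 :: real)"
    by (intro sum.cong refl) (simp add: sum_constant_scaleR)
  then show ?thesis
    using state_gauss_prod_cos_sq[OF assms, of \<epsilon> "\<lambda>_. v"]
    by (simp only: sum_card_eq[OF assms] central_ratio_def)
qed

text \<open>Each surviving exponential tends to 1; in the limit the field is a single uniform
  phase.\<close>

lemma state_gauss_prod_cos_sq_tendsto:
  fixes y :: "'i \<Rightarrow> 'v::real_inner"
  assumes "finite I"
  shows "((\<lambda>\<epsilon>. state (gauss \<epsilon>) (\<Prod>i\<in>I. cos_sq (1, y i))) \<longlongrightarrow> central_ratio (card I)) (at_right 0)"
proof -
  have "((\<lambda>\<epsilon>. if P then exp (- (\<epsilon> * r)) else 0) \<longlongrightarrow> (if P then 1 else 0)) (at_right 0)" for P and r :: real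
    by (auto intro!: tendsto_eq_intros)
  then show ?thesis
    unfolding state_gauss_prod_cos_sq[OF assms] central_ratio_def sum_card_eq[OF assms, symmetric]
    by (intro tendsto_divide tendsto_sum tendsto_const) auto
qed

section \<open>Moments with two distinguished points\<close>

definition moment :: "('g \<Rightarrow> 'v::real_inner) \<Rightarrow> real \<Rightarrow> nat \<Rightarrow> 'g \<Rightarrow> 'g \<Rightarrow> 'g set \<Rightarrow> real" where
  "moment b \<epsilon> s g g' D = state (gauss \<epsilon>)
     (cos_sq (1, b g) ^ s * cos_sq (1, b g') ^ s * (\<Prod>x\<in>D. cos_sq (1, b x)))"

text \<open>
  The second component is only a tag that keeps the copies of \<open>g\<close>, of \<open>g'\<close> and of the elements
  of \<open>D\<close> apart.
\<close>

definition moment_index :: "nat \<Rightarrow> 'g \<Rightarrow> 'g \<Rightarrow> 'g set \<Rightarrow> ('g \<times> nat) set" where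
  "moment_index s g g' D = {g} \<times> {..<s} \<union> ({g'} \<times> {s..<2 * s} \<union> D \<times> {2 * s})"

lemma finite_moment_index: "finite D \<Longrightarrow> finite (moment_index s g g' D)"
  by (simp add: moment_index_def)

lemma card_moment_index: "finite D \<Longrightarrow> card (moment_index s g g' D) = 2 * s + card D"
  unfolding moment_index_def
  by (subst card_Un_disjoint; (subst card_Un_disjoint)?) (auto simp: card_cartesian_product)

lemma moment_eq:
  fixes b :: "'g \<Rightarrow> 'v::real_inner"
  assumes "finite D"
  shows "moment b \<epsilon> s g g' D = state (gauss \<epsilon>) (\<Prod>i\<in>moment_index s g g' D. cos_sq (1, b (fst i)))"
proof -
  have prod_fst: "(\<Prod>i\<in>A \<times> B. f (fst i)) = (\<Prod>x\<in>A. f x ^ card B)"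
    for A :: "'g set" and B :: "nat set" and f :: "'g \<Rightarrow> (int \<times> 'v) \<Rightarrow>\<^sub>0 real"
    using prod.cartesian_product[of "\<lambda>x _. f x" B A] by (simp add: case_prod_unfold)
  have "(\<Prod>i\<in>moment_index s g g' D. cos_sq (1 :: int, b (fst i)))
    = (\<Prod>i\<in>{g} \<times> {..<s}. cos_sq (1, b (fst i))) *
      ((\<Prod>i\<in>{g'} \<times> {s..<2 * s}. cos_sq (1, b (fst i))) * (\<Prod>i\<in>D \<times> {2 * s}. cos_sq (1, b (fst i))))"
    unfolding moment_index_def using assms
    by (subst prod.union_disjoint; (subst prod.union_disjoint)?) auto
  also have "\<dots> = cos_sq (1, b g) ^ s * (cos_sq (1, b g') ^ s * (\<Prod>x\<in>D. cos_sq (1, b x)))"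
    by (simp add: prod_fst[where f = "\<lambda>x. cos_sq (1, b x)"])
  finally show ?thesis by (simp add: moment_def mult.assoc)
qed

lemma moment_commute: "moment b \<epsilon> s g g' D = moment b \<epsilon> s g' g D"
  by (simp add: moment_def mult_ac)

lemma moment_empty: "moment b \<epsilon> s g g {} = central_ratio (2 * s)"
proof -
  have "moment b \<epsilon> s g g {} = state (gauss \<epsilon>) (\<Prod>i\<in>{..<2 * s}. cos_sq (1, b g))"
    by (simp add: moment_def mult_2 power_add)
  then show ?thesis by (simp only: state_gauss_prod_cos_sq_const finite_lessThan card_lessThan)
qed

lemma moment_tendsto:
  assumes "finite D"
  shows "((\<lambda>\<epsilon>. moment b \<epsilon> s g g' D) \<longlongrightarrow> central_ratio (2 * s + card D)) (at_right 0)"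
  using state_gauss_prod_cos_sq_tendsto[OF finite_moment_index[OF assms], of "\<lambda>i. b (fst i)" s g g']
  by (simp add: moment_eq[OF assms] card_moment_index[OF assms])

lemma moment_image:
  assumes D: "finite D" and inj: "inj_on \<pi> D"
    and dist: "\<And>x y. x \<in> {g, g'} \<union> D \<Longrightarrow> y \<in> {g, g'} \<union> D \<Longrightarrow> norm (b (\<pi> x) - b (\<pi> y)) = norm (b x - b y)"
  shows "moment b \<epsilon> s (\<pi> g) (\<pi> g') (\<pi> ` D) = moment b \<epsilon> s g g' D"
proof -
  have "moment b \<epsilon> s (\<pi> g) (\<pi> g') (\<pi> ` D) = moment (b \<circ> \<pi>) \<epsilon> s g g' D"
    by (simp add: moment_def prod.reindex[OF inj])
  also have "\<dots> = moment b \<epsilon> s g g' D"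
    unfolding moment_eq[OF D]
    by (rule state_gauss_prod_cos_sq_cong[OF finite_moment_index[OF D]])
      (auto simp: moment_index_def intro!: dist)
  finally show ?thesis .
qed

lemma moment_kernel_nonneg:
  fixes b :: "'g \<Rightarrow> 'v::real_inner" and w :: "nat \<Rightarrow> 'g \<Rightarrow> 'h" and g :: "nat \<Rightarrow> 'g" and r :: "nat \<Rightarrow> real"
  assumes "0 \<le> \<epsilon>" "finite S"
  shows "0 \<le> (\<Sum>i<n. \<Sum>j<n. r i * r j * moment b \<epsilon> s (g i) (g j) {x\<in>S. w i x \<noteq> w j x})"
  unfolding moment_def
  by (rule state_kernel_nonneg[OF pos_def_fun_gauss]) (simp_all add: assms star_power star_cos_sq)

text \<open>\<open>cos_sq ?l\<close> is one half plus a quarter of the phase at \<open>x\<close> and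
  of its inverse. The half yields half the normalising constant; each phase term yields at most
  \<open>?\<gamma> / 4\<close>.\<close>

lemma moment_singleton_le:
  fixes b :: "'g \<Rightarrow> 'v::real_inner"
  assumes "0 \<le> \<epsilon>"
  shows "moment b \<epsilon> s g g {x} \<le> central_ratio (2 * s) / 2 + exp (- (\<epsilon> * (norm (b x - b g))\<^sup>2)) / 2"
proof -
  let ?k = "(1, b g) :: int \<times> 'v" and ?l = "(1, b x) :: int \<times> 'v"
  let ?\<gamma> = "exp (- (\<epsilon> * (norm (b x - b g))\<^sup>2))"
  let ?J = "{..<2 * s}"
  define P where "P = (\<Prod>i\<in>?J. cos_sq ?k)"
  define N where "N = real (card (Pow ?J))"
  have P: "P = (\<Sum>A\<in>Pow ?J. \<Sum>B\<in>Pow ?J.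
      Poly_Mapping.single ((\<Sum>i\<in>A. ?k) - (\<Sum>i\<in>B. ?k)) ((1 / 2) ^ (2 * s) * (1 / 2) ^ (2 * s)))"
    unfolding P_def prod_cos_sq by (simp add: prod_half_sum star_sum sum_product mult_single del: prod_constant)
  \<comment> \<open>The coefficients of \<open>P\<close> have total 1, so a uniform bound on
    \<open>gauss\<close> passes to the state.\<close>
  have card: "N * N * ((1 / 2) ^ (2 * s) * (1 / 2) ^ (2 * s)) = 1"
  proof -
    have "(2 :: real) ^ n * 2 ^ n * ((1 / 2) ^ n * (1 / 2) ^ n) = 1" for n
      by (simp flip: power_mult_distrib)
    then show ?thesis by (simp add: N_def card_Pow)
  qed
  have shift: "state (gauss \<epsilon>) (P * Poly_Mapping.single m (1 / 4)) \<le> ?\<gamma> / 4"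
    if m: "m = ?l \<or> m = - ?l" for m
  proof -
    have bound: "gauss \<epsilon> ((\<Sum>i\<in>A. ?k) - (\<Sum>i\<in>B. ?k) + m) \<le> ?\<gamma>" for A B :: "nat set"
    proof -
      \<comment> \<open>\<open>z\<close> is the net power of the phase at \<open>g\<close>. Only the
        \<open>z\<close> cancelling the integer part of \<open>m\<close> survives, leaving
        \<open>b x - b g\<close> up to sign.\<close>
      define z where "z = int (card A) - int (card B)"
      have "(\<Sum>i\<in>A. ?k) - (\<Sum>i\<in>B. ?k) = (z, of_int z *\<^sub>R b g)"
        by (simp add: prod_eq_iff fst_sum snd_sum z_def sum_constant_scaleR scaleR_diff_left)
      moreover have "gauss \<epsilon> ((z, of_int z *\<^sub>R b g) + ?l) \<le> ?\<gamma>"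
        by (cases "z = -1") (auto simp: gauss_def)
      moreover have "gauss \<epsilon> ((z, of_int z *\<^sub>R b g) - ?l) \<le> ?\<gamma>"
        by (cases "z = 1") (auto simp: gauss_def norm_minus_commute)
      ultimately show ?thesis using m by auto
    qed
    have "state (gauss \<epsilon>) (P * Poly_Mapping.single m (1 / 4))
      = (\<Sum>A\<in>Pow ?J. \<Sum>B\<in>Pow ?J. (1 / 2) ^ (2 * s) * (1 / 2) ^ (2 * s) / 4 *
          gauss \<epsilon> ((\<Sum>i\<in>A. ?k) - (\<Sum>i\<in>B. ?k) + m))"
      unfolding P by (simp add: sum_distrib_right mult_single state_sum)
    also have "\<dots> \<le> (\<Sum>A\<in>Pow ?J. \<Sum>B\<in>Pow ?J. (1 / 2) ^ (2 * s) * (1 / 2) ^ (2 * s) / 4 * ?\<gamma>)"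
      by (intro sum_mono mult_left_mono bound) auto
    also have "\<dots> = N * N * ((1 / 2) ^ (2 * s) * (1 / 2) ^ (2 * s)) * (?\<gamma> / 4)"
      by (simp add: N_def)
    finally show ?thesis by (simp only: card mult_1)
  qed
  have "moment b \<epsilon> s g g {x} = state (gauss \<epsilon>) (P * cos_sq ?l)"
    by (simp add: moment_def P_def mult_2 power_add)
  also have "cos_sq ?l = Poly_Mapping.single 0 (1 / 4) + Poly_Mapping.single 0 (1 / 4)
      + Poly_Mapping.single ?l (1 / 4) + Poly_Mapping.single (- ?l) (1 / 4)"
    by (simp add: cos_sq_def half_sum_def star_add distrib_left distrib_right mult_single zero_prod_def)
  also have "state (gauss \<epsilon>) (P * \<dots>) = state (gauss \<epsilon>) (P * Poly_Mapping.single 0 (1 / 4)) + state (gauss \<epsilon>) (P * Poly_Mapping.single 0 (1 / 4))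
      + state (gauss \<epsilon>) (P * Poly_Mapping.single ?l (1 / 4)) + state (gauss \<epsilon>) (P * Poly_Mapping.single (- ?l) (1 / 4))"
    by (simp only: distrib_left state_add)
  also have "state (gauss \<epsilon>) (P * Poly_Mapping.single 0 (1 / 4)) = central_ratio (2 * s) / 4"
    using state_gauss_prod_cos_sq_const[of ?J \<epsilon> "b g"] state_single_mult[of "gauss \<epsilon>" "1 / 4" P]
    by (simp add: mult.commute P_def)
  finally show ?thesis using shift[of ?l] shift[of "- ?l"] by simp
qed

text \<open>Positivity of \<open>(?u - ?v)^2 * ?Q\<close> bounds the mixed moment by the mean of the
  diagonal ones. The one at \<open>g'\<close> is at most \<open>central_ratio (2 * s)\<close>; the
  one at \<open>g\<close> is bounded by keeping only the factor at \<open>x\<close>, whence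
  \<open>(1 + 1 / 2) / 2 = 3 / 4\<close>.\<close>

lemma moment_le:
  fixes b :: "'g \<Rightarrow> 'v::real_inner"
  assumes \<epsilon>: "0 \<le> \<epsilon>" and D: "finite D" "x \<in> D"
  shows "moment b \<epsilon> s g g' D \<le> 3 / 4 * central_ratio (2 * s) + exp (- (\<epsilon> * (norm (b x - b g))\<^sup>2)) / 4"
proof -
  note \<tau> = pos_def_fun_gauss[OF \<epsilon>, where ?'v = 'v]
  let ?c = "\<lambda>x. cos_sq (1 :: int, b x)" and ?Q = "\<Prod>x\<in>D. cos_sq (1 :: int, b x)"
  let ?h = "\<Prod>x\<in>D. half_sum (1 :: int, b x)"
  let ?u = "?c g ^ s" and ?v = "?c g' ^ s"
  have star_u: "star (?c g ^ s) = ?c g ^ s" for g by (simp add: star_power star_cos_sq)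
  have square: "((?u - ?v) * ?h) * star ((?u - ?v) * ?h) = ?u * ?u * ?Q + ?v * ?v * ?Q - ?u * ?v * ?Q - ?u * ?v * ?Q"
    unfolding prod_cos_sq star_mult star_diff star_u by (simp add: algebra_simps)
  have "0 \<le> moment b \<epsilon> s g g D + moment b \<epsilon> s g' g' D - 2 * moment b \<epsilon> s g g' D"
    using state_mult_star_nonneg[OF \<tau>, of "(?u - ?v) * ?h"]
    unfolding square state_add state_diff by (simp add: moment_def)
  moreover have "moment b \<epsilon> s g' g' D \<le> central_ratio (2 * s)"
    using state_mult_prod_cos_sq_le[OF \<tau> D(1), of ?v "\<lambda>x. (1, b x)"] moment_empty[of b \<epsilon> s g']
    by (simp add: moment_def star_u)
  moreover have "moment b \<epsilon> s g g D \<le> moment b \<epsilon> s g g {x}"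
  proof -
    let ?a = "?u * half_sum (1, b x)"
    have a: "?a * star ?a = ?u * ?u * ?c x"
      unfolding star_mult star_u by (simp add: cos_sq_def[of "(1, b x)"] mult_ac)
    have "?u * ?u * ?Q = ?a * star ?a * (\<Prod>x\<in>D - {x}. ?c x)"
      unfolding a using D by (simp add: prod.remove mult.assoc)
    then have "moment b \<epsilon> s g g D = state (gauss \<epsilon>) (?a * star ?a * (\<Prod>x\<in>D - {x}. ?c x))"
      by (simp only: moment_def)
    also have "\<dots> \<le> state (gauss \<epsilon>) (?a * star ?a)"
      by (rule state_mult_prod_cos_sq_le[OF \<tau>]) (use D in simp)
    also have "\<dots> = moment b \<epsilon> s g g {x}"
      unfolding a by (simp add: moment_def)
    finally show ?thesis .
  qed
  moreover note moment_singleton_le[OF \<epsilon>, of b s g x]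
  ultimately show ?thesis by simp
qed

section \<open>Isometric actions from conditionally negative definite kernels\<close>

text \<open>The last column involves only the last unknown; solving for it leaves a smaller system
  with a corrected right-hand side.\<close>

lemma triangular_system_solvable:
  fixes L :: "nat \<Rightarrow> nat \<Rightarrow> real"
  assumes diag: "\<And>j. j < n \<Longrightarrow> L j j \<noteq> 0" and tri: "\<And>j k. j < k \<Longrightarrow> L j k = 0"
  shows "\<exists>c. \<forall>k<n. (\<Sum>j<n. c j * L j k) = v k"
  using diag
proof (induction n arbitrary: v)
  case 0
  then show ?case by simp
next
  case (Suc n)
  let ?t = "v n / L n n"
  obtain c where c: "\<forall>k<n. (\<Sum>j<n. c j * L j k) = v k - ?t * L n k"
    using Suc.IH[of "\<lambda>k. v k - ?t * L n k"] Suc.prems by auto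
  have "(\<Sum>j<Suc n. (c(n := ?t)) j * L j k) = v k" if "k < Suc n" for k
  proof (cases "k = n")
    case True
    then show ?thesis using Suc.prems[of n] tri by simp
  next
    case False
    then show ?thesis using c that by simp
  qed
  then show ?case by blast
qed

function cholesky :: "(nat \<Rightarrow> nat \<Rightarrow> real) \<Rightarrow> nat \<Rightarrow> nat \<Rightarrow> real" where
  "cholesky M i j =
     (if i < j then 0
      else if i = j then sqrt (M i i - (\<Sum>k<i. (cholesky M i k)\<^sup>2))
      else (M i j - (\<Sum>k<j. cholesky M i k * cholesky M j k)) / cholesky M j j)"
  by pat_completeness auto
termination
  by (relation "inv_image (less_than <*lex*> less_than) (\<lambda>(M, i, j). (i, j))") auto

declare cholesky.simps [simp del]

lemma cholesky_above [simp]: "i < j \<Longrightarrow> cholesky M i j = 0"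
  by (simp add: cholesky.simps)

lemma cholesky_row:
  assumes "j < i" "cholesky M j j \<noteq> 0"
  shows "(\<Sum>k\<le>j. cholesky M i k * cholesky M j k) = M i j"
proof -
  have "cholesky M i j * cholesky M j j = M i j - (\<Sum>k<j. cholesky M i k * cholesky M j k)"
    using assms by (subst cholesky.simps[of M i j]) simp
  then show ?thesis by (simp add: lessThan_Suc_atMost[symmetric])
qed

text \<open>A combination \<open>c\<close> of the earlier rows agrees with row \<open>i\<close>
  before the diagonal. The form of \<open>M\<close> at \<open>c\<close> extended by
  \<open>-1\<close> is then exactly the radicand of \<open>cholesky M i i\<close>.\<close>

lemma cholesky_diag_pos:
  assumes sym: "\<And>i j. M i j = M j i"
    and pos: "\<And>n c. c n \<noteq> 0 \<Longrightarrow> 0 < (\<Sum>i\<le>n. \<Sum>j\<le>n. c i * c j * M i j)"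
  shows "0 < cholesky M i i"
proof (induction i rule: less_induct)
  case (less i)
  let ?L = "cholesky M"
  have row: "M a b = (\<Sum>k<i. ?L a k * ?L b k)" if "b < a" "a \<le> i" for a b
  proof -
    have "M a b = (\<Sum>k\<le>b. ?L a k * ?L b k)"
      using that less[of b] by (intro cholesky_row[symmetric]) auto
    also have "\<dots> = (\<Sum>k<i. ?L a k * ?L b k)"
      using that by (intro sum.mono_neutral_left) auto
    finally show ?thesis .
  qed
  have diag: "M a a = (\<Sum>k<i. ?L a k * ?L a k)" if "a < i" for a
  proof -
    have "?L a a = sqrt (M a a - (\<Sum>k<a. (?L a k)\<^sup>2))"
      by (subst cholesky.simps) simp
    with less[OF that] have "(?L a a)\<^sup>2 = M a a - (\<Sum>k<a. (?L a k)\<^sup>2)"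
      by (metis real_sqrt_gt_0_iff real_sqrt_pow2 less_imp_le)
    then have "M a a = (\<Sum>k\<le>a. ?L a k * ?L a k)"
      by (simp add: lessThan_Suc_atMost[symmetric] power2_eq_square)
    also have "\<dots> = (\<Sum>k<i. ?L a k * ?L a k)"
      using that by (intro sum.mono_neutral_left) auto
    finally show ?thesis .
  qed
  have gram: "M a b = (\<Sum>k<i. ?L a k * ?L b k)" if "a < i" "b < i" for a b
    using row[of a b] row[of b a] diag[of a] that sym[of a b]
    by (cases a b rule: linorder_cases) (auto simp: mult.commute)
  obtain c where c: "\<And>k. k < i \<Longrightarrow> (\<Sum>j<i. c j * ?L j k) = ?L i k"
    using triangular_system_solvable[of i ?L "?L i"] less by fastforce
  have cross: "(\<Sum>j<i. c j * M i j) = (\<Sum>k<i. (?L i k)\<^sup>2)"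
  proof -
    have "(\<Sum>j<i. c j * M i j) = (\<Sum>j<i. \<Sum>k<i. ?L i k * (c j * ?L j k))"
      using row by (intro sum.cong refl) (simp add: sum_distrib_left mult_ac)
    also have "\<dots> = (\<Sum>k<i. ?L i k * (\<Sum>j<i. c j * ?L j k))"
      by (subst sum.swap) (simp add: sum_distrib_left)
    finally show ?thesis using c by (simp add: power2_eq_square)
  qed
  have square: "(\<Sum>a<i. \<Sum>b<i. c a * c b * M a b) = (\<Sum>k<i. (?L i k)\<^sup>2)"
  proof -
    have "(\<Sum>a<i. \<Sum>b<i. c a * c b * M a b)
        = (\<Sum>a<i. \<Sum>b<i. \<Sum>k<i. (c a * ?L a k) * (c b * ?L b k))"
      using gram by (intro sum.cong refl) (simp add: sum_distrib_left mult_ac)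
    also have "\<dots> = (\<Sum>a<i. \<Sum>k<i. \<Sum>b<i. (c a * ?L a k) * (c b * ?L b k))"
      by (intro sum.cong refl sum.swap)
    also have "\<dots> = (\<Sum>k<i. \<Sum>a<i. \<Sum>b<i. (c a * ?L a k) * (c b * ?L b k))"
      by (rule sum.swap)
    also have "\<dots> = (\<Sum>k<i. (\<Sum>a<i. c a * ?L a k) * (\<Sum>b<i. c b * ?L b k))"
      by (simp only: sum_product)
    finally show ?thesis using c by (simp add: power2_eq_square)
  qed
  have "0 < (\<Sum>a\<le>i. \<Sum>b\<le>i. (c(i := -1)) a * (c(i := -1)) b * M a b)"
    by (rule pos) simp
  also have "\<dots> = M i i - (\<Sum>k<i. (?L i k)\<^sup>2)"
  proof -
    have "(\<Sum>a<i. c a * M a i) = (\<Sum>j<i. c j * M i j)"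
      using sym by (intro sum.cong) auto
    then show ?thesis
      using cross square
      by (simp add: lessThan_Suc_atMost[symmetric] sum_subtractf sum_negf)
  qed
  finally show ?case by (subst cholesky.simps) simp
qed

text \<open>The \<open>b i\<close> are the rows of the Cholesky factor. Being triangular with
  nonzero diagonal, they span all finitely supported sequences, which are dense.\<close>

lemma ell2_realization:
  fixes M :: "nat \<Rightarrow> nat \<Rightarrow> real"
  assumes sym: "\<And>i j. M i j = M j i"
    and pos: "\<And>n c. c n \<noteq> 0 \<Longrightarrow> 0 < (\<Sum>i\<le>n. \<Sum>j\<le>n. c i * c j * M i j)"
  obtains b :: "nat \<Rightarrow> ell2"
  where "\<And>i j. inner (b i) (b j) = M i j" "closure (span (range b)) = UNIV"
proof -
  let ?L = "cholesky M"
  have L_pos: "0 < ?L i i" for i by (rule cholesky_diag_pos[OF sym pos])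
  have fin_supp: "summable (\<lambda>n. (f n)\<^sup>2)" if "\<And>n. n > m \<Longrightarrow> f n = 0" for f :: "nat \<Rightarrow> real" and m
    by (rule summable_finite[of "{..m}"]) (use that in \<open>auto simp: not_le\<close>)
  define b where "b i = Abs_ell2 (?L i)" for i
  have nth_b: "ell2_nth (b i) = ?L i" for i
    unfolding b_def by (rule Abs_ell2_inverse) (use fin_supp[of i "?L i"] in simp)
  have gram_le: "inner (b i) (b j) = M i j" if "j \<le> i" for i j
  proof -
    have "inner (b i) (b j) = (\<Sum>k\<le>j. ?L i k * ?L j k)"
      unfolding inner_ell2_def nth_b by (rule suminf_finite) (auto simp: not_le)
    also have "\<dots> = M i j"
    proof (cases "j < i")
      case True
      then show ?thesis using L_pos[of j] by (intro cholesky_row) auto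
    next
      case False
      with that have "i = j" by simp
      moreover have "(?L j j)\<^sup>2 = M j j - (\<Sum>k<j. (?L j k)\<^sup>2)"
        using L_pos[of j] cholesky.simps[of M j j]
        by (metis less_irrefl real_sqrt_gt_0_iff real_sqrt_pow2 less_imp_le)
      ultimately show ?thesis
        by (simp add: lessThan_Suc_atMost[symmetric] power2_eq_square)
    qed
    finally show ?thesis .
  qed
  have gram: "inner (b i) (b j) = M i j" for i j
    using gram_le[of i j] gram_le[of j i] sym[of i j] inner_commute[of "b i" "b j"]
    by (cases "j \<le> i") auto
  have in_span: "x \<in> span (range b)" if "\<And>k. k \<ge> n \<Longrightarrow> ell2_nth x k = 0" for n x
    using that
  proof (induction n arbitrary: x)
    case 0
    then have "x = 0"
      by (auto simp: ell2_nth_inject[symmetric] zero_ell2.rep_eq)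
    then show ?case by (simp add: span_zero)
  next
    case (Suc n)
    \<comment> \<open>This clears coordinate \<open>n\<close>; \<open>b n\<close> vanishes beyond
      \<open>n\<close>, so later zeros survive.\<close>
    define y where "y = x - (ell2_nth x n / ?L n n) *\<^sub>R b n"
    have "y \<in> span (range b)"
    proof (rule Suc.IH)
      fix k assume "n \<le> k"
      then show "ell2_nth y k = 0"
        using Suc.prems[of k] L_pos[of n]
        by (cases "k = n") (auto simp: y_def minus_ell2.rep_eq scaleR_ell2.rep_eq nth_b)
    qed
    then have "y + (ell2_nth x n / ?L n n) *\<^sub>R b n \<in> span (range b)"
      by (intro span_add span_scale) (auto intro: span_base)
    then show ?case by (simp add: y_def)
  qed
  have "x \<in> closure (span (range b))" for x
    unfolding closure_sequential
  proof (intro exI conjI allI)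
    let ?t = "\<lambda>n k. if k < n then ell2_nth x k else 0"
    define y where "y n = Abs_ell2 (?t n)" for n
    have nth_y: "ell2_nth (y n) = ?t n" for n
      unfolding y_def by (rule Abs_ell2_inverse) (use fin_supp[of n "?t n"] in simp)
    show "y n \<in> span (range b)" for n
      by (rule in_span[of n]) (simp add: nth_y)
    let ?S = "\<lambda>n. \<Sum>k<n. (ell2_nth x k)\<^sup>2"
    have norm_eq: "(norm (y n - x))\<^sup>2 = suminf (\<lambda>k. (ell2_nth x k)\<^sup>2) - ?S n" for n
    proof -
      have "(norm (y n - x))\<^sup>2 = suminf (\<lambda>k. (ell2_nth x k)\<^sup>2 - (?t n k)\<^sup>2)"
        unfolding power2_norm_eq_inner inner_ell2_def
        by (intro suminf_cong) (simp add: minus_ell2.rep_eq nth_y power2_eq_square)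
      also have "\<dots> = suminf (\<lambda>k. (ell2_nth x k)\<^sup>2) - suminf (\<lambda>k. (?t n k)\<^sup>2)"
        using fin_supp[of n "?t n"] by (intro suminf_diff[symmetric] summable_ell2_nth_sq) auto
      also have "suminf (\<lambda>k. (?t n k)\<^sup>2) = (\<Sum>k<n. (?t n k)\<^sup>2)"
        by (rule suminf_finite) auto
      finally show ?thesis by simp
    qed
    have "(\<lambda>n. suminf (\<lambda>k. (ell2_nth x k)\<^sup>2) - ?S n) \<longlonglongrightarrow> suminf (\<lambda>k. (ell2_nth x k)\<^sup>2) - suminf (\<lambda>k. (ell2_nth x k)\<^sup>2)"
      by (intro tendsto_intros summable_LIMSEQ summable_ell2_nth_sq)
    then have "(\<lambda>n. (norm (y n - x))\<^sup>2) \<longlonglongrightarrow> 0" by (simp add: norm_eq)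
    then have "(\<lambda>n. sqrt ((norm (y n - x))\<^sup>2)) \<longlonglongrightarrow> sqrt 0" by (rule tendsto_real_sqrt)
    then show "y \<longlonglongrightarrow> x" by (simp add: tendsto_norm_zero_iff LIM_zero_iff)
  qed
  with gram show thesis by (intro that[of b]) auto
qed

text \<open>A linear map is defined on a basis chosen among the \<open>b i\<close>, so
  well-definedness is automatic. It preserves inner products on the span and extends to the closure
  by uniform continuity.\<close>

lemma isometry_extension:
  fixes b b' :: "'i \<Rightarrow> 'a::{real_inner,complete_space}"
  assumes gram: "\<And>i j. i \<in> I \<Longrightarrow> j \<in> I \<Longrightarrow> inner (b' i) (b' j) = inner (b i) (b j)"
    and dense: "closure (span (b ` I)) = UNIV"
  obtains U :: "'a \<Rightarrow> 'a" where "\<And>x y. dist (U x) (U y) = dist x y" "\<And>i. i \<in> I \<Longrightarrow> U (b i) = b' i"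
proof -
  obtain B where B: "B \<subseteq> b ` I" "independent B" "b ` I \<subseteq> span B"
    by (rule maximal_independent_subset)
  define r where "r = inv_into I b"
  have r: "r x \<in> I" "b (r x) = x" if "x \<in> B" for x
    using that B(1) by (auto simp: r_def inv_into_into f_inv_into_f)
  obtain g where g: "linear g" and gB: "\<And>x. x \<in> B \<Longrightarrow> g x = b' (r x)"
    using linear_independent_extend[OF B(2), of "\<lambda>x. b' (r x)"] by blast
  interpret g: linear g by fact
  have inner_g: "inner (g x) (b' i) = inner x (b i)" if "x \<in> span B" "i \<in> I" for x i
    using that(1)
  proof (induction rule: span_induct)
    case base
    show ?case
      by (rule subspaceI)
        (simp_all add: g.zero g.add g.scale inner_add_left)
  next
    case (step x)
    then show ?case using r[of x] gB[of x] gram[of "r x" i] that(2) by simp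
  qed
  have inner_gg: "inner (g x) (g y) = inner x y" if "y \<in> span B" "x \<in> span B" for x y
    using that(1)
  proof (induction rule: span_induct)
    case base
    show ?case
      by (rule subspaceI)
        (simp_all add: g.zero g.add g.scale inner_add_right)
  next
    case (step y)
    then show ?case using r[of y] gB[of y] inner_g[OF that(2), of "r y"] by simp
  qed
  \<comment> \<open>Those \<open>b i\<close> outside the basis are also mapped correctly: the inner
    products force \<open>g (b i) - b' i\<close> to have norm 0.\<close>
  have gb: "g (b i) = b' i" if "i \<in> I" for i
  proof -
    have bi: "b i \<in> span B" using B(3) that by blast
    have "inner (g (b i) - b' i) (g (b i) - b' i) = 0"
      using inner_gg[OF bi bi] inner_g[OF bi that] gram[OF that that]
      by (simp add: inner_diff_left inner_diff_right inner_commute)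
    then show ?thesis by simp
  qed
  have "span (b ` I) = span B"
    using B by (metis span_mono span_span span_superset subset_antisym subset_trans)
  then have UNIV: "closure (span B) = UNIV" using dense by simp
  have isom: "dist (g x) (g y) = dist x y" if "x \<in> span B" "y \<in> span B" for x y
  proof -
    have "x - y \<in> span B" using that by (rule span_diff)
    then have "norm (g (x - y)) = norm (x - y)" by (simp add: norm_eq_sqrt_inner inner_gg)
    then show ?thesis by (simp add: dist_norm g.diff)
  qed
  then have "uniformly_continuous_on (span B) g"
    unfolding uniformly_continuous_on_def by metis
  then obtain U where U: "uniformly_continuous_on (closure (span B)) U"
    and Ug: "\<And>x. x \<in> span B \<Longrightarrow> g x = U x"
    by (rule uniformly_continuous_on_extension_on_closure) blast
  have cont: "continuous (at x) U" for x
    using uniformly_continuous_imp_continuous[OF U] UNIV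
    by (simp add: continuous_on_eq_continuous_at)
  have isoU: "dist (U x) (U y) = dist x y" for x y
  proof -
    obtain f where f: "\<And>n. f n \<in> span B" "f \<longlonglongrightarrow> x"
      using UNIV by (metis UNIV_I closure_sequential)
    obtain h where h: "\<And>n. h n \<in> span B" "h \<longlonglongrightarrow> y"
      using UNIV by (metis UNIV_I closure_sequential)
    have "(\<lambda>n. dist (U (f n)) (U (h n))) \<longlonglongrightarrow> dist (U x) (U y)"
      by (intro tendsto_dist isCont_tendsto_compose[OF cont] f h)
    moreover have "(\<lambda>n. dist (U (f n)) (U (h n))) = (\<lambda>n. dist (f n) (h n))"
      using f h by (simp add: Ug[symmetric] isom)
    moreover have "(\<lambda>n. dist (f n) (h n)) \<longlonglongrightarrow> dist x y"
      by (intro tendsto_dist f h)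
    ultimately show ?thesis using LIMSEQ_unique by metis
  qed
  moreover have "U (b i) = b' i" if "i \<in> I" for i
    using Ug[of "b i"] gb[OF that] B(3) that by auto
  ultimately show thesis by (rule that)
qed

section \<open>Conditionally negative definite kernels and the actions they define\<close>

definition cond_negative :: "'a set \<Rightarrow> ('a \<Rightarrow> 'a \<Rightarrow> real) \<Rightarrow> bool" where
  "cond_negative S \<psi> \<longleftrightarrow>
     (\<forall>x\<in>S. \<psi> x x = 0) \<and> (\<forall>x\<in>S. \<forall>y\<in>S. \<psi> x y = \<psi> y x) \<and>
     (\<forall>n x (c :: nat \<Rightarrow> real). (\<forall>i<n. x i \<in> S) \<longrightarrow> (\<Sum>i<n. c i) = 0 \<longrightarrow>
        (\<Sum>i<n. \<Sum>j<n. c i * c j * \<psi> (x i) (x j)) \<le> 0)"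

lemma cond_negativeD:
  fixes u :: "nat \<Rightarrow> 'a" and c :: "nat \<Rightarrow> real"
  assumes "cond_negative S \<psi>"
  shows "x \<in> S \<Longrightarrow> \<psi> x x = 0" "x \<in> S \<Longrightarrow> y \<in> S \<Longrightarrow> \<psi> x y = \<psi> y x"
    "(\<And>i. i < n \<Longrightarrow> u i \<in> S) \<Longrightarrow> (\<Sum>i<n. c i) = 0 \<Longrightarrow>
       (\<Sum>i<n. \<Sum>j<n. c i * c j * \<psi> (u i) (u j)) \<le> 0"
  using assms unfolding cond_negative_def by blast+

text \<open>Schoenberg's device: append \<open>o'\<close> with minus the total weight, so that
  conditional negativity applies to the longer tuple.\<close>

lemma cond_negative_gram_nonneg:
  fixes x :: "nat \<Rightarrow> 'a" and c :: "nat \<Rightarrow> real"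
  assumes \<psi>: "cond_negative S \<psi>" and x: "\<And>i. i < n \<Longrightarrow> x i \<in> S" and o: "o' \<in> S"
  shows "0 \<le> (\<Sum>i<n. \<Sum>j<n. c i * c j * (\<psi> (x i) o' + \<psi> (x j) o' - \<psi> (x i) (x j)))"
proof -
  let ?s = "\<Sum>i<n. c i" and ?t = "\<Sum>i<n. c i * \<psi> (x i) o'"
  let ?q = "\<Sum>i<n. \<Sum>j<n. c i * c j * \<psi> (x i) (x j)"
  have "(\<Sum>i<Suc n. \<Sum>j<Suc n. (c(n := - ?s)) i * (c(n := - ?s)) j * \<psi> ((x(n := o')) i) ((x(n := o')) j)) \<le> 0"
    by (rule cond_negativeD(3)[OF \<psi>]) (use x o in auto)
  also have "(\<Sum>i<Suc n. \<Sum>j<Suc n. (c(n := - ?s)) i * (c(n := - ?s)) j * \<psi> ((x(n := o')) i) ((x(n := o')) j))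
      = ?q - ?s * (\<Sum>i<n. c i * \<psi> (x i) o') - ?s * (\<Sum>j<n. c j * \<psi> o' (x j)) + ?s * ?s * \<psi> o' o'"
    by (simp add: sum.distrib sum_negf sum_distrib_left sum_subtractf algebra_simps)
  also have "(\<Sum>j<n. c j * \<psi> o' (x j)) = ?t"
    using cond_negativeD(2)[OF \<psi>] x o by (intro sum.cong) auto
  also have "\<psi> o' o' = 0" using cond_negativeD(1)[OF \<psi>] o by simp
  finally have *: "?q - 2 * ?s * ?t \<le> 0" by simp
  have "(\<Sum>i<n. \<Sum>j<n. c i * c j * (\<psi> (x i) o' + \<psi> (x j) o' - \<psi> (x i) (x j)))
     = (\<Sum>i<n. \<Sum>j<n. (c i * \<psi> (x i) o') * c j) + (\<Sum>i<n. \<Sum>j<n. c i * (c j * \<psi> (x j) o')) - ?q"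
    by (simp add: sum.distrib[symmetric] sum_subtractf[symmetric] algebra_simps)
  also have "\<dots> = ?t * ?s + ?s * ?t - ?q" by (simp only: sum_product)
  finally show ?thesis using * by simp
qed

lemma group_action_UNIV_I:
  assumes "group G"
    and "\<And>g. g \<in> carrier G \<Longrightarrow> bij (\<phi> g)"
    and "\<And>g h x. g \<in> carrier G \<Longrightarrow> h \<in> carrier G \<Longrightarrow> \<phi> (g \<otimes>\<^bsub>G\<^esub> h) x = \<phi> g (\<phi> h x)"
  shows "group_action G UNIV \<phi>"
proof -
  have "\<phi> \<in> hom G (BijGroup UNIV)"
    using assms by (auto simp: hom_def BijGroup_def Bij_def compose_def)
  with assms(1) show ?thesis
    by (simp add: group_action_def group_hom_def group_hom_axioms_def group_BijGroup)
qed

text \<open>If \<open>\<phi> g\<close> maps some point of a ball of radius \<open>R\<close> about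
  \<open>o'\<close> back into the ball, it moves \<open>o'\<close> by at most
  \<open>2 * R\<close>.\<close>

lemma metrically_properI:
  fixes \<phi> :: "'g \<Rightarrow> 'x::metric_space \<Rightarrow> 'x"
  assumes "group_action G UNIV \<phi>"
    and iso: "\<And>g x y. g \<in> carrier G \<Longrightarrow> dist (\<phi> g x) (\<phi> g y) = dist x y"
    and fin: "\<And>R. finite {g \<in> carrier G. dist (\<phi> g o') o' \<le> R}"
  shows "metrically_proper G \<phi>"
  unfolding metrically_proper_def
proof (intro allI impI)
  fix B :: "'x set" assume "bounded B"
  then obtain R where R: "\<And>x. x \<in> B \<Longrightarrow> dist o' x \<le> R" unfolding bounded_any_center[of _ o'] by blast
  have "dist (\<phi> g o') o' \<le> 2 * R" if "g \<in> carrier G" "x \<in> B" "\<phi> g x \<in> B" for g x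
    using dist_triangle[of "\<phi> g o'" o' "\<phi> g x"] iso[OF that(1), of o' x] R[OF that(2)] R[OF that(3)]
    by (simp add: dist_commute)
  then have "{g \<in> carrier G. \<phi> g ` B \<inter> B \<noteq> {}} \<subseteq> {g \<in> carrier G. dist (\<phi> g o') o' \<le> 2 * R}" by blast
  with fin show "finite {g \<in> carrier G. \<phi> g ` B \<inter> B \<noteq> {}}" by (rule finite_subset[rotated])
qed

text \<open>The group is placed in \<open>ell2\<close> with squared distances given by
  \<open>\<psi>\<close> plus a constant off the diagonal. Left translations preserve these distances
  and extend to isometries of the whole space.\<close>

lemma haagerup_ell2I:
  fixes G (structure)
  assumes "group G" and count: "countable (carrier G)"
    and \<psi>: "cond_negative (carrier G) \<psi>"
    and inv: "\<And>g p q. g \<in> carrier G \<Longrightarrow> p \<in> carrier G \<Longrightarrow> q \<in> carrier G \<Longrightarrow>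
      \<psi> (g \<otimes> p) (g \<otimes> q) = \<psi> p q"
    and proper: "\<And>R. finite {g \<in> carrier G. \<psi> \<one> g \<le> R}"
  shows "haagerup TYPE(ell2) G"
proof (cases "finite (carrier G)")
  \<comment> \<open>Every action of a finite group is metrically proper, so the trivial one serves.
    The bijective enumeration below needs an infinite carrier.\<close>
  case True
  have "group_action G UNIV (\<lambda>_ x. x :: ell2)"
    by (rule group_action_UNIV_I) (auto simp: assms bij_id[unfolded id_def])
  with True show ?thesis
    unfolding haagerup_def isometric_action_def metrically_proper_def
    by (intro conjI assms exI[of _ "\<lambda>_ x. x"]) auto
next
  case False
  interpret group G by fact
  define e where "e = from_nat_into (carrier G)"
  have bij_e: "bij_betw e UNIV (carrier G)"
    unfolding e_def using count False by (rule bij_betw_from_nat_into)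
  have e_in: "e i \<in> carrier G" for i using bij_e by (auto simp: bij_betw_def)
  have inj_e: "e i = e j \<longleftrightarrow> i = j" for i j using bij_e by (auto simp: bij_betw_def inj_def)
  \<comment> \<open>The summand 2 makes the Gram matrix of the nontrivial orbit points strictly positive
    definite; triangularity of its Cholesky factor then makes their span dense.\<close>
  define \<psi>' where "\<psi>' p q = \<psi> p q + (if p = q then 0 else 2)" for p q
  define M where "M i j = (\<psi>' (e (Suc i)) (e 0) + \<psi>' (e (Suc j)) (e 0) - \<psi>' (e (Suc i)) (e (Suc j))) / 2" for i j
  have sym: "\<psi>' p q = \<psi>' q p" if "p \<in> carrier G" "q \<in> carrier G" for p q
    using cond_negativeD(2)[OF \<psi> that] by (simp add: \<psi>'_def)
  have refl: "\<psi>' p p = 0" if "p \<in> carrier G" for p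
    using cond_negativeD(1)[OF \<psi> that] by (simp add: \<psi>'_def)
  have inv': "\<psi>' (g \<otimes> p) (g \<otimes> q) = \<psi>' p q" if "g \<in> carrier G" "p \<in> carrier G" "q \<in> carrier G" for g p q
    using inv[OF that] that by (simp add: \<psi>'_def)
  have M_sym: "M i j = M j i" for i j
    using sym e_in by (simp add: M_def)
  have M_pos: "0 < (\<Sum>i\<le>n. \<Sum>j\<le>n. c i * c j * M i j)" if "c n \<noteq> 0" for c n
  proof -
    let ?K = "\<lambda>i j. \<psi> (e (Suc i)) (e 0) + \<psi> (e (Suc j)) (e 0) - \<psi> (e (Suc i)) (e (Suc j))"
    \<comment> \<open>The added 2s give \<open>(2 + 2 - 2) / 2 = 1\<close> off the diagonal and
      \<open>(2 + 2 - 0) / 2 = 2\<close> on it.\<close>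
    have M: "M i j = ?K i j / 2 + 1 + (if i = j then 1 else 0)" for i j
      by (simp add: M_def \<psi>'_def inj_e)
    have "0 \<le> (\<Sum>i<Suc n. \<Sum>j<Suc n. c i * c j * ?K i j)"
      by (rule cond_negative_gram_nonneg[OF \<psi>]) (auto simp: e_in)
    then have "0 \<le> (\<Sum>i\<le>n. \<Sum>j\<le>n. c i * c j * (?K i j / 2))"
      by (simp add: lessThan_Suc_atMost sum_divide_distrib[symmetric] del: sum.lessThan_Suc)
    moreover have "(\<Sum>i\<le>n. \<Sum>j\<le>n. c i * c j) = (\<Sum>i\<le>n. c i)\<^sup>2"
      by (simp add: power2_eq_square sum_product)
    then have "0 \<le> (\<Sum>i\<le>n. \<Sum>j\<le>n. c i * c j)" by simp
    moreover have "(\<Sum>i\<le>n. \<Sum>j\<le>n. c i * c j * (if i = j then 1 else 0)) = (\<Sum>i\<le>n. (c i)\<^sup>2)"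
      by (simp add: if_distrib power2_eq_square cong: if_cong)
    moreover have "0 < (\<Sum>i\<le>n. (c i)\<^sup>2)"
      by (rule sum_pos2[of _ n]) (use that in auto)
    moreover have "(\<Sum>i\<le>n. \<Sum>j\<le>n. c i * c j * M i j)
        = (\<Sum>i\<le>n. \<Sum>j\<le>n. c i * c j * (?K i j / 2)) + (\<Sum>i\<le>n. \<Sum>j\<le>n. c i * c j)
          + (\<Sum>i\<le>n. \<Sum>j\<le>n. c i * c j * (if i = j then 1 else 0))"
      by (simp only: M distrib_left mult_1_right sum.distrib)
    ultimately show ?thesis by linarith
  qed
  obtain b :: "nat \<Rightarrow> ell2" where b: "\<And>i j. inner (b i) (b j) = M i j" "closure (span (range b)) = UNIV"
    using ell2_realization[OF M_sym M_pos] by blast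
  \<comment> \<open>\<open>e 0\<close> becomes the origin and \<open>e (Suc i)\<close> becomes
    \<open>b i\<close>, matching the index shift in \<open>M\<close>.\<close>
  define B where "B p = (case inv_into UNIV e p of 0 \<Rightarrow> 0 | Suc i \<Rightarrow> b i)" for p
  have B_e: "B (e i) = (case i of 0 \<Rightarrow> 0 | Suc i \<Rightarrow> b i)" for i
    using bij_e by (simp add: B_def bij_betw_def)
  have inner_B_e: "2 * inner (B (e i)) (B (e j)) = \<psi>' (e i) (e 0) + \<psi>' (e j) (e 0) - \<psi>' (e i) (e j)" for i j
    using refl[of "e 0"] sym[of "e 0" "e j"] sym[of "e 0" "e i"] e_in
    by (cases i; cases j) (simp_all add: B_e b M_def)
  have norm_B_e: "(norm (B (e i) - B (e j)))\<^sup>2 = \<psi>' (e i) (e j)" for i j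
    using inner_B_e[of i j] inner_B_e[of i i] inner_B_e[of j j] refl e_in
    by (simp add: power2_norm_eq_inner inner_diff_left inner_diff_right inner_commute)
  have ex_e: "\<exists>i. p = e i" if "p \<in> carrier G" for p
    using bij_e that by (auto simp: bij_betw_def)
  have norm_B: "(norm (B p - B q))\<^sup>2 = \<psi>' p q" if "p \<in> carrier G" "q \<in> carrier G" for p q
    using norm_B_e that[THEN ex_e] by blast
  have polar: "2 * inner (u - w) (v - w) = (norm (u - w))\<^sup>2 + (norm (v - w))\<^sup>2 - (norm (u - v))\<^sup>2"
    for u v w :: ell2
    by (simp add: power2_norm_eq_inner inner_diff_left inner_diff_right inner_commute)
  have B0: "B (e 0) = 0" by (simp add: B_e)
  have "range b \<subseteq> B ` carrier G"
  proof
    fix x assume "x \<in> range b"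
    then obtain i where "x = B (e (Suc i))" by (auto simp: B_e)
    then show "x \<in> B ` carrier G" using e_in by blast
  qed
  then have dense: "closure (span (B ` carrier G)) = UNIV"
    using b(2) by (metis closure_mono span_mono top.extremum_uniqueI)
  \<comment> \<open>Points are determined by their distances to the orbit, so the extended
    isometries automatically compose as the group elements do.\<close>
  have unique: "x = y" if eq: "\<And>p. p \<in> carrier G \<Longrightarrow> dist x (B p) = dist y (B p)" for x y
  proof -
    have "norm x = norm y" using eq[of "e 0"] e_in by (simp add: B0)
    have orth: "inner (x - y) (B p) = 0" if p: "p \<in> carrier G" for p
    proof -
      have "(norm (x - B p))\<^sup>2 = (norm (y - B p))\<^sup>2" using eq[OF p] by (simp add: dist_norm)
      moreover have "inner x x = inner y y"
        using \<open>norm x = norm y\<close> by (simp add: power2_norm_eq_inner[symmetric])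
      ultimately show ?thesis
        by (simp add: power2_norm_eq_inner inner_diff_left inner_diff_right inner_commute)
    qed
    have "span (B ` carrier G) \<subseteq> {z. inner (x - y) z = 0}"
      by (rule span_minimal) (use orth in \<open>auto simp: subspace_hyperplane\<close>)
    then have "closure (span (B ` carrier G)) \<subseteq> {z. inner (x - y) z = 0}"
      by (rule closure_minimal) (rule closed_hyperplane)
    then have "inner (x - y) (x - y) = 0" using dense by blast
    then show ?thesis by simp
  qed
  have "\<exists>T :: ell2 \<Rightarrow> ell2. (\<forall>x y. dist (T x) (T y) = dist x y) \<and> (\<forall>p\<in>carrier G. T (B p) = B (g \<otimes> p))"
    if g: "g \<in> carrier G" for g
  proof -
    \<comment> \<open>Subtracting the image of the origin reduces the affine problem to inner
      products; the translation is restored afterwards.\<close>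
    let ?w = "B (g \<otimes> e 0)"
    have gram: "inner (B (g \<otimes> p) - ?w) (B (g \<otimes> q) - ?w) = inner (B p) (B q)"
      if pq: "p \<in> carrier G" "q \<in> carrier G" for p q
      using polar[of "B (g \<otimes> p)" ?w "B (g \<otimes> q)"] polar[of "B p" "B (e 0)" "B q"] pq g e_in
      by (simp add: norm_B inv' del: B0) (simp add: B0)
    obtain U where U: "\<And>x y. dist (U x) (U y) = dist x y" "\<And>p. p \<in> carrier G \<Longrightarrow> U (B p) = B (g \<otimes> p) - ?w"
      using isometry_extension[OF gram dense] by blast
    show ?thesis
      by (rule exI[of _ "\<lambda>x. U x + ?w"]) (simp add: U)
  qed
  then obtain \<phi> where iso: "\<And>g x y. g \<in> carrier G \<Longrightarrow> dist (\<phi> g x) (\<phi> g y) = dist x (y :: ell2)"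
    and \<phi>B: "\<And>g p. g \<in> carrier G \<Longrightarrow> p \<in> carrier G \<Longrightarrow> \<phi> g (B p) = B (g \<otimes> p)"
    by metis
  have act: "\<phi> (g \<otimes> h) x = \<phi> g (\<phi> h x)" if g: "g \<in> carrier G" and h: "h \<in> carrier G" for g h x
  proof (rule unique)
    fix p assume p: "p \<in> carrier G"
    \<comment> \<open>Both sides of the claim send \<open>B ?q\<close> to \<open>B p\<close>, so
      both distances equal that from \<open>x\<close> to \<open>B ?q\<close>.\<close>
    let ?q = "inv (g \<otimes> h) \<otimes> p"
    have q: "?q \<in> carrier G" "p = g \<otimes> (h \<otimes> ?q)"
      using g h p by (auto simp: m_assoc[symmetric])
    have "dist (\<phi> (g \<otimes> h) x) (B p) = dist (\<phi> (g \<otimes> h) x) (\<phi> (g \<otimes> h) (B ?q))"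
      using g h p q by (simp add: \<phi>B m_assoc[symmetric])
    moreover have "dist (\<phi> g (\<phi> h x)) (B p) = dist (\<phi> g (\<phi> h x)) (\<phi> g (\<phi> h (B ?q)))"
      using g h q(1) by (subst q(2)) (simp add: \<phi>B)
    ultimately show "dist (\<phi> (g \<otimes> h) x) (B p) = dist (\<phi> g (\<phi> h x)) (B p)"
      using g h by (simp add: iso)
  qed
  have one: "\<phi> \<one> x = x" for x
  proof (rule unique)
    fix p assume p: "p \<in> carrier G"
    then show "dist (\<phi> \<one> x) (B p) = dist x (B p)"
      using iso[of \<one> x "B p"] \<phi>B[of \<one> p] by simp
  qed
  have action: "group_action G UNIV \<phi>"
  proof (rule group_action_UNIV_I)
    fix g assume g: "g \<in> carrier G"
    show "bij (\<phi> g)"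
      by (rule bij_betw_byWitness[of _ "\<phi> (inv g)"])
        (use g one in \<open>auto simp: act[symmetric]\<close>)
  qed (auto simp: act assms)
  have "finite {g \<in> carrier G. dist (\<phi> g (B \<one>)) (B \<one>) \<le> R}" for R
  proof (rule finite_subset[OF _ proper[of "R\<^sup>2"]], clarify)
    fix g assume g: "g \<in> carrier G" and le: "dist (\<phi> g (B \<one>)) (B \<one>) \<le> R"
    have "\<psi> \<one> g \<le> \<psi>' g \<one>" using sym[of g \<one>] g by (simp add: \<psi>'_def)
    also have "\<dots> = (dist (\<phi> g (B \<one>)) (B \<one>))\<^sup>2"
      using g by (simp add: \<phi>B norm_B dist_norm)
    also have "\<dots> \<le> R\<^sup>2" using le by (intro power_mono) auto
    finally show "\<psi> \<one> g \<le> R\<^sup>2" .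
  qed
  then have "metrically_proper G \<phi>"
    using metrically_properI[OF action] iso by blast
  with action iso show ?thesis
    unfolding haagerup_def isometric_action_def by (intro conjI assms exI[of _ \<phi>]) auto
qed

section \<open>Closure properties of conditionally negative definite kernels\<close>

lemma cond_negativeI:
  assumes "\<And>x. x \<in> S \<Longrightarrow> \<psi> x x = 0" "\<And>x y. x \<in> S \<Longrightarrow> y \<in> S \<Longrightarrow> \<psi> x y = \<psi> y x"
    and "\<And>n (u :: nat \<Rightarrow> 'a) (c :: nat \<Rightarrow> real). (\<And>i. i < n \<Longrightarrow> u i \<in> S) \<Longrightarrow> (\<Sum>i<n. c i) = 0 \<Longrightarrow>
      (\<Sum>i<n. \<Sum>j<n. c i * c j * \<psi> (u i) (u j)) \<le> 0"
  shows "cond_negative S \<psi>"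
  using assms unfolding cond_negative_def by blast

lemma cond_negative_one_minus:
  fixes K :: "'a \<Rightarrow> 'a \<Rightarrow> real"
  assumes "\<And>x. x \<in> S \<Longrightarrow> K x x = 1" "\<And>x y. x \<in> S \<Longrightarrow> y \<in> S \<Longrightarrow> K x y = K y x"
    and pos: "\<And>n (u :: nat \<Rightarrow> 'a) (c :: nat \<Rightarrow> real). (\<And>i. i < n \<Longrightarrow> u i \<in> S) \<Longrightarrow>
      0 \<le> (\<Sum>i<n. \<Sum>j<n. c i * c j * K (u i) (u j))"
  shows "cond_negative S (\<lambda>x y. 1 - K x y)"
proof (rule cond_negativeI)
  fix n and u :: "nat \<Rightarrow> 'a" and c :: "nat \<Rightarrow> real"
  assume u: "\<And>i. i < n \<Longrightarrow> u i \<in> S" and c: "(\<Sum>i<n. c i) = 0"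
  have "(\<Sum>i<n. \<Sum>j<n. c i * c j * (1 - K (u i) (u j)))
    = (\<Sum>i<n. c i) * (\<Sum>j<n. c j) - (\<Sum>i<n. \<Sum>j<n. c i * c j * K (u i) (u j))"
    by (simp add: sum_product right_diff_distrib sum_subtractf)
  with pos[of n u c, OF u] c show "(\<Sum>i<n. \<Sum>j<n. c i * c j * (1 - K (u i) (u j))) \<le> 0" by simp
qed (simp_all add: assms)

lemma cond_negative_add:
  assumes "cond_negative S \<psi>" "cond_negative S \<psi>'"
  shows "cond_negative S (\<lambda>x y. \<psi> x y + \<psi>' x y)"
proof (rule cond_negativeI)
  fix n and u :: "nat \<Rightarrow> 'a" and c :: "nat \<Rightarrow> real"
  assume u: "\<And>i. i < n \<Longrightarrow> u i \<in> S" and c: "(\<Sum>i<n. c i) = 0"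
  show "(\<Sum>i<n. \<Sum>j<n. c i * c j * (\<psi> (u i) (u j) + \<psi>' (u i) (u j))) \<le> 0"
    using cond_negativeD(3)[OF assms(1), of n u c, OF u c] cond_negativeD(3)[OF assms(2), of n u c, OF u c]
    by (simp add: distrib_left sum.distrib)
qed (use cond_negativeD[OF assms(1)] cond_negativeD[OF assms(2)] in auto)

lemma cond_negative_suminf:
  assumes \<psi>: "\<And>m :: nat. cond_negative S (\<psi> m)"
    and sum: "\<And>x y. x \<in> S \<Longrightarrow> y \<in> S \<Longrightarrow> summable (\<lambda>m. \<psi> m x y)"
  shows "cond_negative S (\<lambda>x y. suminf (\<lambda>m. \<psi> m x y))"
proof (rule cond_negativeI)
  fix n and u :: "nat \<Rightarrow> 'a" and c :: "nat \<Rightarrow> real"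
  assume u: "\<And>i. i < n \<Longrightarrow> u i \<in> S" and c: "(\<Sum>i<n. c i) = 0"
  have "(\<lambda>m. \<Sum>i<n. \<Sum>j<n. c i * c j * \<psi> m (u i) (u j)) sums
      (\<Sum>i<n. \<Sum>j<n. c i * c j * suminf (\<lambda>m. \<psi> m (u i) (u j)))"
    using sum u by (intro sums_sum sums_mult summable_sums) auto
  then show "(\<Sum>i<n. \<Sum>j<n. c i * c j * suminf (\<lambda>m. \<psi> m (u i) (u j))) \<le> 0"
    by (rule sums_le[OF _ _ sums_zero, rotated]) (rule cond_negativeD(3)[OF \<psi> u c])
qed (simp_all add: cond_negativeD(1,2)[OF \<psi>] cong: suminf_cong)

lemma sum_norm_diff_sq_le_0:
  fixes y :: "nat \<Rightarrow> 'v::real_inner" and c :: "nat \<Rightarrow> real"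
  assumes "(\<Sum>i<n. c i) = 0"
  shows "(\<Sum>i<n. \<Sum>j<n. c i * c j * (norm (y i - y j))\<^sup>2) \<le> 0"
  using norm_sum_zero_weights[OF assms, of y] zero_le_power2[of "norm (\<Sum>i<n. c i *\<^sub>R y i)"] by linarith

lemma cond_negative_norm_sq:
  fixes f :: "'a \<Rightarrow> 'v::real_inner"
  shows "cond_negative S (\<lambda>x y. (norm (f x - f y))\<^sup>2)"
  by (rule cond_negativeI) (auto simp: norm_minus_commute intro: sum_norm_diff_sq_le_0)

section \<open>Kernels on lamp configurations\<close>

definition differ :: "'x set \<Rightarrow> ('x \<Rightarrow> 'h) \<times> 'g \<Rightarrow> ('x \<Rightarrow> 'h) \<times> 'g \<Rightarrow> 'x set" where
  "differ X p q = {x\<in>X. fst p x \<noteq> fst q x}"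

lemma differ_commute: "differ X p q = differ X q p"
  by (auto simp: differ_def)

lemma differ_refl [simp]: "differ X p p = {}"
  by (auto simp: differ_def)

text \<open>Positivity of the moments refers to one finite set for all pairs; the union of the
  pairwise differences provides it.\<close>

lemma finite_differ_family:
  assumes "\<And>i j. i < n \<Longrightarrow> j < (n :: nat) \<Longrightarrow> finite (differ X (u i) (u j))"
  obtains S where "finite S" "\<And>i j. i < n \<Longrightarrow> j < n \<Longrightarrow> differ X (u i) (u j) = {x\<in>S. fst (u i) x \<noteq> fst (u j) x}"
proof (rule that)
  let ?S = "\<Union>i<n. \<Union>j<n. differ X (u i) (u j)"
  show "finite ?S" using assms by blast
  show "differ X (u i) (u j) = {x\<in>?S. fst (u i) x \<noteq> fst (u j) x}" if "i < n" "j < n" for i j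
    using that by (auto simp: differ_def)
qed

text \<open>Terms outside the difference set vanish, so all sums may run over a common finite
  \<open>T\<close>; each point contributes a squared-distance kernel.\<close>

lemma cond_negative_sum_differ:
  fixes a :: "'h \<Rightarrow> 'v::real_inner"
  assumes fin: "\<And>p q. p \<in> S \<Longrightarrow> q \<in> S \<Longrightarrow> finite (differ X p q)"
  shows "cond_negative S (\<lambda>p q. \<Sum>x\<in>differ X p q. (norm (a (fst p x) - a (fst q x)))\<^sup>2)"
proof (rule cond_negativeI)
  fix n and u :: "nat \<Rightarrow> ('a \<Rightarrow> 'h) \<times> 'b" and c :: "nat \<Rightarrow> real"
  assume u: "\<And>i. i < n \<Longrightarrow> u i \<in> S" and c: "(\<Sum>i<n. c i) = 0"
  obtain T where T: "finite T" "\<And>i j. i < n \<Longrightarrow> j < n \<Longrightarrow> differ X (u i) (u j) = {x\<in>T. fst (u i) x \<noteq> fst (u j) x}"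
    using finite_differ_family[of n X u] fin u by blast
  let ?d = "\<lambda>i j x. (norm (a (fst (u i) x) - a (fst (u j) x)))\<^sup>2"
  have "(\<Sum>i<n. \<Sum>j<n. c i * c j * (\<Sum>x\<in>differ X (u i) (u j). ?d i j x))
    = (\<Sum>i<n. \<Sum>j<n. \<Sum>x\<in>T. c i * c j * ?d i j x)"
  proof (intro sum.cong refl)
    fix i j assume "i \<in> {..<n}" "j \<in> {..<n}"
    then have "(\<Sum>x\<in>differ X (u i) (u j). ?d i j x) = (\<Sum>x\<in>T. ?d i j x)"
      using T by (intro sum.mono_neutral_left) auto
    then show "c i * c j * (\<Sum>x\<in>differ X (u i) (u j). ?d i j x) = (\<Sum>x\<in>T. c i * c j * ?d i j x)"
      by (simp only: sum_distrib_left)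
  qed
  also have "\<dots> = (\<Sum>i<n. \<Sum>x\<in>T. \<Sum>j<n. c i * c j * ?d i j x)"
    by (intro sum.cong refl sum.swap)
  also have "\<dots> = (\<Sum>x\<in>T. \<Sum>i<n. \<Sum>j<n. c i * c j * ?d i j x)"
    by (rule sum.swap)
  also have "\<dots> \<le> 0"
    by (rule sum_nonpos) (rule sum_norm_diff_sq_le_0[OF c])
  finally show "(\<Sum>i<n. \<Sum>j<n. c i * c j * (\<Sum>x\<in>differ X (u i) (u j). ?d i j x)) \<le> 0" .
qed (auto simp: differ_commute norm_minus_commute)

definition lamp_kernel ::
  "'g set \<Rightarrow> ('g \<Rightarrow> 'v::real_inner) \<Rightarrow> real \<Rightarrow> nat \<Rightarrow> ('g \<Rightarrow> 'h) \<times> 'g \<Rightarrow> ('g \<Rightarrow> 'h) \<times> 'g \<Rightarrow> real" where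
  "lamp_kernel X b \<epsilon> s p q = moment b \<epsilon> s (snd p) (snd q) (differ X p q) / central_ratio (2 * s)"

lemma lamp_kernel_refl: "lamp_kernel X b \<epsilon> s p p = 1"
  using central_ratio_pos[of "2 * s"] by (simp add: lamp_kernel_def moment_empty)

lemma cond_negative_lamp_kernel:
  fixes b :: "'g \<Rightarrow> 'v::real_inner" and S :: "(('g \<Rightarrow> 'h) \<times> 'g) set"
  assumes "0 \<le> \<epsilon>" and fin: "\<And>p q. p \<in> S \<Longrightarrow> q \<in> S \<Longrightarrow> finite (differ X p q)"
  shows "cond_negative S (\<lambda>p q. 1 - lamp_kernel X b \<epsilon> s p q)"
proof (rule cond_negative_one_minus)
  fix n and u :: "nat \<Rightarrow> ('g \<Rightarrow> 'h) \<times> 'g" and c :: "nat \<Rightarrow> real"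
  assume u: "\<And>i. i < n \<Longrightarrow> u i \<in> S"
  obtain T where T: "finite T" "\<And>i j. i < n \<Longrightarrow> j < n \<Longrightarrow> differ X (u i) (u j) = {x\<in>T. fst (u i) x \<noteq> fst (u j) x}"
    using finite_differ_family[of n X u] fin u by blast
  have "(\<Sum>i<n. \<Sum>j<n. c i * c j * lamp_kernel X b \<epsilon> s (u i) (u j))
    = (\<Sum>i<n. \<Sum>j<n. c i * c j * moment b \<epsilon> s (snd (u i)) (snd (u j)) {x\<in>T. fst (u i) x \<noteq> fst (u j) x}) / central_ratio (2 * s)"
    by (simp add: lamp_kernel_def T(2) sum_divide_distrib)
  also have "\<dots> \<ge> 0"
    using moment_kernel_nonneg[OF assms(1) T(1)] central_ratio_pos[of "2 * s"]
    by (intro divide_nonneg_nonneg) (auto intro: less_imp_le)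
  finally show "0 \<le> (\<Sum>i<n. \<Sum>j<n. c i * c j * lamp_kernel X b \<epsilon> s (u i) (u j))" .
qed (simp_all add: lamp_kernel_refl lamp_kernel_def[of X b \<epsilon> s] moment_empty differ_commute moment_commute)

text \<open>Weights 1 and -1 on \<open>x\<close> and \<open>y\<close> give
  \<open>- 2 * \<psi> x y \<le> 0\<close>.\<close>

lemma cond_negative_nonneg:
  assumes "cond_negative S \<psi>" "x \<in> S" "y \<in> S"
  shows "0 \<le> \<psi> x y"
proof -
  have "(\<Sum>i<(2::nat). \<Sum>j<(2::nat). (if i = 0 then 1 else -1) * (if j = 0 then 1 else -1) *
      \<psi> (if i = 0 then x else y) (if j = 0 then x else y)) \<le> 0"
    by (rule cond_negativeD(3)[OF assms(1)]) (use assms in \<open>auto simp: numeral_2_eq_2\<close>)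
  then show ?thesis
    using cond_negativeD(1,2)[OF assms(1)] assms by (simp add: numeral_2_eq_2)
qed

lemma lamp_kernel_le:
  assumes "0 < \<epsilon>"
  shows "\<exists>R. \<forall>p q x. finite (differ X p q) \<longrightarrow> x \<in> differ X p q \<longrightarrow>
    R < norm (b x - b (snd p)) \<longrightarrow> lamp_kernel X b \<epsilon> s p q \<le> 7 / 8"
proof -
  let ?z = "central_ratio (2 * s)"
  have z: "0 < ?z" by (rule central_ratio_pos)
  have "((\<lambda>r. exp (- (\<epsilon> * r\<^sup>2))) \<longlongrightarrow> 0) at_top"
    using assms by real_asymp
  \<comment> \<open>Below \<open>?z / 2\<close>, the bound of \<open>moment_le\<close> becomes
    \<open>3 / 4 + 1 / 8 = 7 / 8\<close> times \<open>?z\<close>.\<close>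
  then have "\<forall>\<^sub>F r in at_top. exp (- (\<epsilon> * r\<^sup>2)) < ?z / 2"
    using z by (intro order_tendstoD) auto
  then obtain R where R: "\<And>r. r \<ge> R \<Longrightarrow> exp (- (\<epsilon> * r\<^sup>2)) < ?z / 2"
    by (auto simp: eventually_at_top_linorder)
  show ?thesis
  proof (intro exI[of _ R] allI impI)
    fix p q x assume *: "finite (differ X p q)" "x \<in> differ X p q" "R < norm (b x - b (snd p))"
    have "moment b \<epsilon> s (snd p) (snd q) (differ X p q) \<le> 7 / 8 * ?z"
      using moment_le[OF _ *(1,2), of \<epsilon> b s "snd p" "snd q"] R[of "norm (b x - b (snd p))"] *(3) assms
      by simp
    then show "lamp_kernel X b \<epsilon> s p q \<le> 7 / 8"
      using z by (simp add: lamp_kernel_def divide_le_eq)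
  qed
qed

text \<open>First \<open>s\<close> is taken large against the numbers of differing lamps, so that
  the limits for \<open>\<epsilon>\<close> to 0 exceed \<open>1 - \<delta>\<close>; then one small
  \<open>\<epsilon>\<close> serves the finite set \<open>Q\<close>.\<close>

lemma lamp_kernel_near_1:
  fixes b :: "'g \<Rightarrow> 'v::real_inner"
  assumes "finite Q" and fin: "\<And>q. q \<in> Q \<Longrightarrow> finite (differ X p q)" and "0 < \<delta>"
  shows "\<exists>\<epsilon> s. 0 < \<epsilon> \<and> (\<forall>q\<in>Q. 1 - lamp_kernel X b \<epsilon> s p q \<le> \<delta>)"
proof -
  define m where "m = (\<Sum>q\<in>Q. card (differ X p q))"
  have m: "card (differ X p q) \<le> m" if "q \<in> Q" for q
    unfolding m_def by (rule member_le_sum) (use that assms(1) in auto)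
  obtain s :: nat where s: "real m / \<delta> < real s" using reals_Archimedean2 by blast
  let ?z = "central_ratio (2 * s)"
  have z: "0 < ?z" by (rule central_ratio_pos)
  have "\<forall>\<^sub>F \<epsilon> in at_right 0. 1 - lamp_kernel X b \<epsilon> s p q < \<delta>" if q: "q \<in> Q" for q
  proof -
    let ?d = "card (differ X p q)"
    have "real ?d / (2 * real (2 * s) + 2) < \<delta>"
    proof -
      have "real ?d \<le> real m" using m[OF q] by simp
      also have "real m < \<delta> * real s" using s assms(3) by (simp add: field_simps)
      also have "\<dots> \<le> \<delta> * (2 * real (2 * s) + 2)" using assms(3) by (intro mult_left_mono) auto
      finally show ?thesis by (simp add: divide_less_eq)
    qed
    then have "?z * (1 - \<delta>) < ?z * (1 - real ?d / (2 * real (2 * s) + 2))"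
      using z by (intro mult_strict_left_mono) auto
    also have "\<dots> \<le> central_ratio (2 * s + ?d)" by (rule central_ratio_add_ge)
    finally have "1 - \<delta> < central_ratio (2 * s + ?d) / ?z" using z by (simp add: field_simps)
    moreover have "((\<lambda>\<epsilon>. lamp_kernel X b \<epsilon> s p q) \<longlongrightarrow> central_ratio (2 * s + ?d) / ?z) (at_right 0)"
      unfolding lamp_kernel_def using z by (intro tendsto_divide moment_tendsto fin q tendsto_const) auto
    ultimately have "\<forall>\<^sub>F \<epsilon> in at_right 0. 1 - \<delta> < lamp_kernel X b \<epsilon> s p q"
      by (rule order_tendstoD(1)[rotated])
    then show ?thesis by eventually_elim simp
  qed
  then have "\<forall>\<^sub>F \<epsilon> in at_right 0. \<forall>q\<in>Q. 1 - lamp_kernel X b \<epsilon> s p q < \<delta>"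
    by (intro eventually_ball_finite assms ballI) auto
  moreover have "\<forall>\<^sub>F \<epsilon> in at_right 0. (0 :: real) < \<epsilon>" by (rule eventually_at_right_less)
  ultimately have "\<forall>\<^sub>F \<epsilon> in at_right 0. 0 < \<epsilon> \<and> (\<forall>q\<in>Q. 1 - lamp_kernel X b \<epsilon> s p q < \<delta>)"
    by eventually_elim blast
  then obtain \<epsilon> :: real where "0 < \<epsilon>" "\<forall>q\<in>Q. 1 - lamp_kernel X b \<epsilon> s p q < \<delta>"
    using eventually_happens'[OF trivial_limit_at_right_real] by blast
  then show ?thesis by (meson less_imp_le)
qed

text \<open>\<open>b\<close> is the orbit of 0. If \<open>\<phi> g\<close> moves 0 by at most
  \<open>R\<close>, then \<open>cball 0 R\<close> meets its image, and properness applies.\<close>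

lemma haagerup_orbit_map:
  fixes G :: "('g, 'm) monoid_scheme" (structure)
  assumes "haagerup TYPE('v::{real_inner,complete_space}) G"
  obtains b :: "'g \<Rightarrow> 'v::{real_inner,complete_space}" where
    "\<And>g h k. g \<in> carrier G \<Longrightarrow> h \<in> carrier G \<Longrightarrow> k \<in> carrier G \<Longrightarrow>
      norm (b (g \<otimes> h) - b (g \<otimes> k)) = norm (b h - b k)"
    "\<And>R. finite {g \<in> carrier G. norm (b \<one> - b g) \<le> R}"
proof -
  obtain \<phi> :: "'g \<Rightarrow> 'v \<Rightarrow> 'v" where \<phi>: "isometric_action G \<phi>" "metrically_proper G \<phi>" and "group G"
    using assms by (auto simp: haagerup_def)
  interpret group G by fact
  interpret group_action G UNIV \<phi> using \<phi>(1) by (simp add: isometric_action_def)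
  have iso: "dist (\<phi> g x) (\<phi> g y) = dist x y" if "g \<in> carrier G" for g x y
    using \<phi>(1) that by (simp add: isometric_action_def)
  have one: "\<phi> \<one> 0 = 0" using id_eq_one by (metis UNIV_I restrict_apply')
  show thesis
  proof (rule that[of "\<lambda>g. \<phi> g 0"])
    show "norm (\<phi> (g \<otimes> h) 0 - \<phi> (g \<otimes> k) 0) = norm (\<phi> h 0 - \<phi> k 0)"
      if "g \<in> carrier G" "h \<in> carrier G" "k \<in> carrier G" for g h k
      using iso[OF that(1), of "\<phi> h 0" "\<phi> k 0"] that by (simp add: composition_rule dist_norm)
    show "finite {g \<in> carrier G. norm (\<phi> \<one> 0 - \<phi> g 0) \<le> R}" for R
    proof (cases "0 \<le> R")
      case True
      have "finite {g \<in> carrier G. \<phi> g ` cball 0 R \<inter> cball 0 R \<noteq> {}}"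
        using \<phi>(2) by (auto simp: metrically_proper_def)
      moreover have "{g \<in> carrier G. norm (\<phi> \<one> 0 - \<phi> g 0) \<le> R}
          \<subseteq> {g \<in> carrier G. \<phi> g ` cball 0 R \<inter> cball 0 R \<noteq> {}}"
      proof clarify
        fix g assume "norm (\<phi> \<one> 0 - \<phi> g 0) \<le> R" "\<phi> g ` cball 0 R \<inter> cball 0 R = {}"
        moreover have "\<phi> g 0 \<in> \<phi> g ` cball 0 R" using True by simp
        ultimately show False by (auto simp: one)
      qed
      ultimately show ?thesis by (rule rev_finite_subset)
    next
      case False
      then have "{g \<in> carrier G. norm (\<phi> \<one> 0 - \<phi> g 0) \<le> R} = {}"
        by (auto simp: not_le intro: less_le_trans)
      then show ?thesis by (metis finite.emptyI)
    qed
  qed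
qed

section \<open>The wreath product\<close>

lemma carrier_wreath_product:
  assumes "group H"
  shows "p \<in> carrier (wreath_product H G) \<longleftrightarrow>
    fst p \<in> carrier G \<rightarrow>\<^sub>E carrier H \<and> finite {x \<in> carrier G. fst p x \<noteq> \<one>\<^bsub>H\<^esub>} \<and> snd p \<in> carrier G"
  by (cases p) (auto simp: wreath_product_def semidirect_product_def carrier_sum_group assms)

lemma fst_mult_wreath_product:
  "x \<in> carrier G \<Longrightarrow> fst (p \<otimes>\<^bsub>wreath_product H G\<^esub> q) x = fst p x \<otimes>\<^bsub>H\<^esub> fst q (inv\<^bsub>G\<^esub> (snd p) \<otimes>\<^bsub>G\<^esub> x)"
  by (cases p; cases q) (simp add: wreath_product_def semidirect_product_def shift_def)

lemma snd_mult_wreath_product: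
  "snd (p \<otimes>\<^bsub>wreath_product H G\<^esub> q) = snd p \<otimes>\<^bsub>G\<^esub> snd q"
  by (cases p; cases q) (simp add: wreath_product_def semidirect_product_def)

lemma one_wreath_product:
  "x \<in> carrier G \<Longrightarrow> fst \<one>\<^bsub>wreath_product H G\<^esub> x = \<one>\<^bsub>H\<^esub>" "snd \<one>\<^bsub>wreath_product H G\<^esub> = \<one>\<^bsub>G\<^esub>"
  by (simp_all add: wreath_product_def semidirect_product_def)

lemma finite_differ_wreath_product:
  assumes "group H" "p \<in> carrier (wreath_product H G)" "q \<in> carrier (wreath_product H G)"
  shows "finite (differ (carrier G) p q)"
proof (rule finite_subset)
  show "differ (carrier G) p q \<subseteq> {x \<in> carrier G. fst p x \<noteq> \<one>\<^bsub>H\<^esub>} \<union> {x \<in> carrier G. fst q x \<noteq> \<one>\<^bsub>H\<^esub>}"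
    by (auto simp: differ_def)
qed (use assms in \<open>simp add: carrier_wreath_product\<close>)

text \<open>An element is coded by the finite graph of its nontrivial lamps and its second
  component.\<close>

lemma countable_wreath_product:
  fixes G :: "('g, 'a) monoid_scheme" and H :: "('h, 'b) monoid_scheme"
  assumes "group H" "countable (carrier G)" "countable (carrier H)"
  shows "countable (carrier (wreath_product H G))"
proof -
  define f where "f p = ((\<lambda>x. (x, fst p x)) ` {x \<in> carrier G. fst p x \<noteq> \<one>\<^bsub>H\<^esub>}, snd p)" for p :: "('g \<Rightarrow> 'h) \<times> 'g"
  let ?F = "{A. finite A \<and> A \<subseteq> carrier G \<times> carrier H}"
  have "f ` carrier (wreath_product H G) \<subseteq> ?F \<times> carrier G"
    by (auto simp: f_def carrier_wreath_product assms(1))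
  moreover have "countable (?F \<times> carrier G)"
    using assms by (intro countable_SIGMA countable_Collect_finite_subset) auto
  moreover have "inj_on f (carrier (wreath_product H G))"
  proof (rule inj_onI)
    fix p q assume p: "p \<in> carrier (wreath_product H G)" and q: "q \<in> carrier (wreath_product H G)"
      and eq: "f p = f q"
    have sub: "fst p' x = fst q' x" if "f p' = f q'" "x \<in> carrier G" "fst p' x \<noteq> \<one>\<^bsub>H\<^esub>" for p' q' x
    proof -
      have "(x, fst p' x) \<in> fst (f p')" using that by (auto simp: f_def)
      then have "(x, fst p' x) \<in> fst (f q')" using that by simp
      then show ?thesis by (auto simp: f_def)
    qed
    have "fst p = fst q"
    proof
      fix x show "fst p x = fst q x"
      proof (cases "x \<in> carrier G")
        case True
        then show ?thesis using sub[OF eq] sub[OF eq[symmetric]] by metis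
      next
        case False
        have "fst p \<in> carrier G \<rightarrow>\<^sub>E carrier H" "fst q \<in> carrier G \<rightarrow>\<^sub>E carrier H"
          using p q by (simp_all add: carrier_wreath_product assms(1))
        then show ?thesis using False by (simp add: PiE_arb[OF _ False])
      qed
    qed
    moreover have "snd p = snd q" using arg_cong[OF eq, of snd] by (simp add: f_def)
    ultimately show "p = q" by (rule prod_eqI)
  qed
  ultimately show ?thesis
    by (meson countable_subset countable_image_inj_on)
qed

text \<open>Left multiplication by \<open>r\<close> shifts positions by \<open>snd r\<close> and
  multiplies both lamps at a point by the same element of \<open>H\<close>, which preserves
  inequality.\<close>

lemma differ_mult_wreath_product:
  assumes G: "group G" and H: "group H"
    and r: "r \<in> carrier (wreath_product H G)" and p: "p \<in> carrier (wreath_product H G)"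
    and q: "q \<in> carrier (wreath_product H G)"
  shows "differ (carrier G) (r \<otimes>\<^bsub>wreath_product H G\<^esub> p) (r \<otimes>\<^bsub>wreath_product H G\<^esub> q)
    = (\<lambda>x. snd r \<otimes>\<^bsub>G\<^esub> x) ` differ (carrier G) p q"
proof -
  interpret G: group G by fact
  interpret H: group H by fact
  have r': "snd r \<in> carrier G" "\<And>x. x \<in> carrier G \<Longrightarrow> fst r x \<in> carrier H"
    and p': "\<And>x. x \<in> carrier G \<Longrightarrow> fst p x \<in> carrier H"
    and q': "\<And>x. x \<in> carrier G \<Longrightarrow> fst q x \<in> carrier H"
    using r p q by (auto simp: carrier_wreath_product[OF H])
  have iff: "x \<in> differ (carrier G) (r \<otimes>\<^bsub>wreath_product H G\<^esub> p) (r \<otimes>\<^bsub>wreath_product H G\<^esub> q) \<longleftrightarrow>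
    x \<in> carrier G \<and> inv\<^bsub>G\<^esub> (snd r) \<otimes>\<^bsub>G\<^esub> x \<in> differ (carrier G) p q" for x
    using r' p' q' by (auto simp: differ_def fst_mult_wreath_product)
  show ?thesis
  proof (rule subset_antisym; rule subsetI)
    fix x assume "x \<in> differ (carrier G) (r \<otimes>\<^bsub>wreath_product H G\<^esub> p) (r \<otimes>\<^bsub>wreath_product H G\<^esub> q)"
    then have x: "x \<in> carrier G" "inv\<^bsub>G\<^esub> (snd r) \<otimes>\<^bsub>G\<^esub> x \<in> differ (carrier G) p q" by (simp_all add: iff)
    have "x = snd r \<otimes>\<^bsub>G\<^esub> (inv\<^bsub>G\<^esub> (snd r) \<otimes>\<^bsub>G\<^esub> x)"
      using x(1) r'(1) by (simp add: G.m_assoc[symmetric])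
    with x(2) show "x \<in> (\<lambda>x. snd r \<otimes>\<^bsub>G\<^esub> x) ` differ (carrier G) p q" by blast
  next
    fix x assume "x \<in> (\<lambda>x. snd r \<otimes>\<^bsub>G\<^esub> x) ` differ (carrier G) p q"
    then obtain y where y: "x = snd r \<otimes>\<^bsub>G\<^esub> y" "y \<in> differ (carrier G) p q" by blast
    then have "y \<in> carrier G" by (simp add: differ_def)
    with y r'(1) show "x \<in> differ (carrier G) (r \<otimes>\<^bsub>wreath_product H G\<^esub> p) (r \<otimes>\<^bsub>wreath_product H G\<^esub> q)"
      by (simp add: iff G.m_assoc[symmetric])
  qed
qed

theorem theorem1p1:
  fixes G :: "('g, 'a) monoid_scheme" and H :: "('h, 'b) monoid_scheme"
  assumes "group G" and "countable (carrier G)"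
    and "group H" and "countable (carrier H)"
    and "haagerup TYPE('v::{real_inner,complete_space}) G"
    and "haagerup TYPE('w::{real_inner,complete_space}) H"
  shows "haagerup TYPE(ell2) (wreath_product H G)"
proof -
  interpret G: group G by fact
  interpret H: group H by fact
  let ?W = "wreath_product H G" and ?D = "differ (carrier G)"
  interpret W: group ?W using assms by (intro group_wreath_product)
  obtain b :: "'g \<Rightarrow> 'v" where b_inv: "\<And>g h k. g \<in> carrier G \<Longrightarrow> h \<in> carrier G \<Longrightarrow> k \<in> carrier G \<Longrightarrow>
      norm (b (g \<otimes>\<^bsub>G\<^esub> h) - b (g \<otimes>\<^bsub>G\<^esub> k)) = norm (b h - b k)"
    and b_fin: "\<And>R. finite {g \<in> carrier G. norm (b \<one>\<^bsub>G\<^esub> - b g) \<le> R}"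
    using haagerup_orbit_map[OF assms(5)] by blast
  obtain a :: "'h \<Rightarrow> 'w" where a_inv: "\<And>g h k. g \<in> carrier H \<Longrightarrow> h \<in> carrier H \<Longrightarrow> k \<in> carrier H \<Longrightarrow>
      norm (a (g \<otimes>\<^bsub>H\<^esub> h) - a (g \<otimes>\<^bsub>H\<^esub> k)) = norm (a h - a k)"
    and a_fin: "\<And>R. finite {g \<in> carrier H. norm (a \<one>\<^bsub>H\<^esub> - a g) \<le> R}"
    using haagerup_orbit_map[OF assms(6)] by blast
  have countable: "countable (carrier ?W)" using assms by (intro countable_wreath_product)
  note finD = finite_differ_wreath_product[OF assms(3)]
  have carr: "snd p \<in> carrier G" "\<And>x. x \<in> carrier G \<Longrightarrow> fst p x \<in> carrier H" if "p \<in> carrier ?W" for p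
    using that by (auto simp: carrier_wreath_product[OF assms(3)])
  have inj: "inj_on (\<lambda>x. h \<otimes>\<^bsub>G\<^esub> x) A" if "h \<in> carrier G" "A \<subseteq> carrier G" for h A
    by (rule inj_onI) (use that in \<open>metis G.Units_eq G.Units_l_cancel subsetD\<close>)
  have D_sub: "?D p q \<subseteq> carrier G" for p q :: "('g \<Rightarrow> 'h) \<times> 'g" by (auto simp: differ_def)

  define f where "f = from_nat_into (carrier ?W)"
  have f_in: "f i \<in> carrier ?W" for i
    unfolding f_def by (rule from_nat_into) (use W.one_closed in blast)
  have f_onto: "\<exists>i. p = f i" if "p \<in> carrier ?W" for p
    using from_nat_into_surj[OF countable that] by (auto simp: f_def)

  \<comment> \<open>The \<open>n\<close>-th kernel is controlled on the first \<open>n + 1\<close>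
    elements only; at a fixed element this misses finitely many \<open>n\<close>, which is enough
    for summability.\<close>
  have "\<exists>\<epsilon> s. 0 < \<epsilon> \<and> (\<forall>q\<in>f ` {..n}. 1 - lamp_kernel (carrier G) b \<epsilon> s \<one>\<^bsub>?W\<^esub> q \<le> (1 / 2) ^ n)" for n
    by (rule lamp_kernel_near_1) (use f_in in \<open>auto intro!: finD W.one_closed\<close>)
  then obtain \<epsilon> s where \<epsilon>s: "\<And>n. 0 < \<epsilon> n \<and>
      (\<forall>q\<in>f ` {..n}. 1 - lamp_kernel (carrier G) b (\<epsilon> n) (s n) \<one>\<^bsub>?W\<^esub> q \<le> (1 / 2) ^ n)"
    by metis
  have \<epsilon>: "0 < \<epsilon> n" for n using \<epsilon>s by blast
  have near: "1 - lamp_kernel (carrier G) b (\<epsilon> n) (s n) \<one>\<^bsub>?W\<^esub> q \<le> (1 / 2) ^ n" if "q \<in> f ` {..n}" for n q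
    using \<epsilon>s that by blast
  define \<kappa> where "\<kappa> n p q = 1 - lamp_kernel (carrier G) b (\<epsilon> n) (s n) p q"
    for n and p q :: "('g \<Rightarrow> 'h) \<times> 'g"
  have \<kappa>_neg: "cond_negative (carrier ?W) (\<kappa> n)" for n
    unfolding \<kappa>_def by (rule cond_negative_lamp_kernel) (use \<epsilon> finD in \<open>auto intro: less_imp_le\<close>)
  have \<kappa>_nonneg: "0 \<le> \<kappa> n p q" if "p \<in> carrier ?W" "q \<in> carrier ?W" for n p q
    using cond_negative_nonneg[OF \<kappa>_neg that] .
  have \<kappa>_inv: "\<kappa> n (r \<otimes>\<^bsub>?W\<^esub> p) (r \<otimes>\<^bsub>?W\<^esub> q) = \<kappa> n p q"
    if r: "r \<in> carrier ?W" and p: "p \<in> carrier ?W" and q: "q \<in> carrier ?W" for n r p q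
  proof -
    have "moment b (\<epsilon> n) (s n) (snd r \<otimes>\<^bsub>G\<^esub> snd p) (snd r \<otimes>\<^bsub>G\<^esub> snd q) ((\<lambda>x. snd r \<otimes>\<^bsub>G\<^esub> x) ` ?D p q)
      = moment b (\<epsilon> n) (s n) (snd p) (snd q) (?D p q)"
      by (rule moment_image[OF finD[OF p q] inj[OF carr(1)[OF r] D_sub]])
        (use b_inv[OF carr(1)[OF r]] carr(1)[OF p] carr(1)[OF q] D_sub in blast)
    then show ?thesis
      by (simp add: \<kappa>_def lamp_kernel_def snd_mult_wreath_product
          differ_mult_wreath_product[OF assms(1,3) r p q])
  qed
  have \<kappa>_summable: "summable (\<lambda>n. \<kappa> n p q)" if p: "p \<in> carrier ?W" and q: "q \<in> carrier ?W" for p q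
  proof -
    \<comment> \<open>Left invariance moves the pair to \<open>\<one>\<close> and \<open>?r\<close>,
      where the estimate \<open>near\<close> applies.\<close>
    let ?r = "inv\<^bsub>?W\<^esub> p \<otimes>\<^bsub>?W\<^esub> q"
    have r: "?r \<in> carrier ?W" using p q by simp
    obtain i where i: "?r = f i" using f_onto[OF r] by blast
    have eq: "\<kappa> n p q = \<kappa> n \<one>\<^bsub>?W\<^esub> ?r" for n
      using \<kappa>_inv[of "inv\<^bsub>?W\<^esub> p" p q n] p q by simp
    show ?thesis
    proof (rule summable_comparison_test')
      show "summable (\<lambda>n. (1 / 2 :: real) ^ n)" by (rule summable_geometric) simp
      fix n assume "n \<ge> i"
      then have "\<kappa> n \<one>\<^bsub>?W\<^esub> ?r \<le> (1 / 2) ^ n"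
        unfolding \<kappa>_def i by (intro near) auto
      then have "\<kappa> n p q \<le> (1 / 2) ^ n" by (simp only: eq)
      then show "norm (\<kappa> n p q) \<le> (1 / 2) ^ n" using \<kappa>_nonneg[OF p q] by simp
    qed
  qed

  define \<alpha> where "\<alpha> p q = (\<Sum>x\<in>?D p q. (norm (a (fst p x) - a (fst q x)))\<^sup>2)"
    for p q :: "('g \<Rightarrow> 'h) \<times> 'g"
  define \<beta> where "\<beta> p q = (norm (b (snd p) - b (snd q)))\<^sup>2" for p q :: "('g \<Rightarrow> 'h) \<times> 'g"
  define \<sigma> where "\<sigma> p q = suminf (\<lambda>n. \<kappa> n p q)" for p q
  have \<alpha>_inv: "\<alpha> (r \<otimes>\<^bsub>?W\<^esub> p) (r \<otimes>\<^bsub>?W\<^esub> q) = \<alpha> p q"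
    if r: "r \<in> carrier ?W" and p: "p \<in> carrier ?W" and q: "q \<in> carrier ?W" for r p q
    unfolding \<alpha>_def differ_mult_wreath_product[OF assms(1,3) r p q]
      sum.reindex[OF inj[OF carr(1)[OF r] D_sub]]
  proof (rule sum.cong[OF refl])
    fix x assume "x \<in> ?D p q"
    then have x: "x \<in> carrier G" using D_sub by blast
    then show "((\<lambda>x. (norm (a (fst (r \<otimes>\<^bsub>?W\<^esub> p) x) - a (fst (r \<otimes>\<^bsub>?W\<^esub> q) x)))\<^sup>2) \<circ> (\<lambda>x. snd r \<otimes>\<^bsub>G\<^esub> x)) x
      = (norm (a (fst p x) - a (fst q x)))\<^sup>2"
      using carr[OF r] carr[OF p] carr[OF q]
      by (simp add: fst_mult_wreath_product G.m_assoc[symmetric] a_inv)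
  qed
  show ?thesis
  proof (rule haagerup_ell2I)
    show "cond_negative (carrier ?W) (\<lambda>p q. \<alpha> p q + (\<beta> p q + \<sigma> p q))"
      unfolding \<alpha>_def \<beta>_def \<sigma>_def
      by (intro cond_negative_add cond_negative_sum_differ cond_negative_norm_sq
          cond_negative_suminf \<kappa>_neg \<kappa>_summable finD)
    show "\<alpha> (r \<otimes>\<^bsub>?W\<^esub> p) (r \<otimes>\<^bsub>?W\<^esub> q) + (\<beta> (r \<otimes>\<^bsub>?W\<^esub> p) (r \<otimes>\<^bsub>?W\<^esub> q) + \<sigma> (r \<otimes>\<^bsub>?W\<^esub> p) (r \<otimes>\<^bsub>?W\<^esub> q))
      = \<alpha> p q + (\<beta> p q + \<sigma> p q)"
      if "r \<in> carrier ?W" "p \<in> carrier ?W" "q \<in> carrier ?W" for r p q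
      using that carr(1)
      by (simp add: \<alpha>_inv \<beta>_def \<sigma>_def \<kappa>_inv snd_mult_wreath_product b_inv)
    fix R
    let ?o = "\<one>\<^bsub>?W\<^esub>"
    let ?C = "{p \<in> carrier ?W. \<alpha> ?o p + (\<beta> ?o p + \<sigma> ?o p) \<le> R}"
    \<comment> \<open>If the first \<open>N\<close> kernels were all at least \<open>1 / 8\<close>,
      their sum would exceed \<open>R\<close>; so on \<open>?C\<close> some \<open>n < N\<close> has
      a smaller value.\<close>
    obtain N :: nat where N: "8 * R < real N" using reals_Archimedean2 by blast
    have "\<exists>\<rho>. \<forall>p q x. finite (?D p q) \<longrightarrow> x \<in> ?D p q \<longrightarrow> \<rho> < norm (b x - b (snd p)) \<longrightarrow>
        1 / 8 \<le> \<kappa> n p q" for n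
    proof -
      have "1 / 8 \<le> \<kappa> n p q \<longleftrightarrow> lamp_kernel (carrier G) b (\<epsilon> n) (s n) p q \<le> 7 / 8" for p q
        by (auto simp: \<kappa>_def)
      then show ?thesis using lamp_kernel_le[OF \<epsilon>, of "carrier G" b n "s n"] by (simp only:)
    qed
    then obtain \<rho> where \<rho>: "\<And>n p q x. finite (?D p q) \<Longrightarrow> x \<in> ?D p q \<Longrightarrow> \<rho> n < norm (b x - b (snd p)) \<Longrightarrow>
        1 / 8 \<le> \<kappa> n p q" by metis
    \<comment> \<open>That \<open>n\<close> confines every differing lamp to distance
      \<open>\<rho> n\<close> from the base point; the union over \<open>n < N\<close> is finite and
      independent of \<open>p\<close>.\<close>
    define E where "E = (\<Union>n<N. {x \<in> carrier G. norm (b \<one>\<^bsub>G\<^esub> - b x) \<le> \<rho> n})"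
    define A where "A = {h \<in> carrier H. norm (a \<one>\<^bsub>H\<^esub> - a h) \<le> sqrt R}"
    define B where "B = {g \<in> carrier G. norm (b \<one>\<^bsub>G\<^esub> - b g) \<le> sqrt R}"
    \<comment> \<open>Rebuilds a lamp configuration from its values on \<open>E\<close>: identity
      elsewhere in \<open>carrier G\<close>, \<open>undefined\<close> outside it.\<close>
    let ?ext = "\<lambda>u. \<lambda>x\<in>carrier G. if x \<in> E then u x else \<one>\<^bsub>H\<^esub>"
    have "finite E" unfolding E_def using b_fin by blast
    then have "finite ((\<lambda>(u, g). (?ext u, g)) ` ((E \<rightarrow>\<^sub>E insert \<one>\<^bsub>H\<^esub> A) \<times> B))"
      unfolding A_def B_def using a_fin b_fin by (intro finite_imageI finite_cartesian_product finite_PiE) auto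
    moreover have "?C \<subseteq> (\<lambda>(u, g). (?ext u, g)) ` ((E \<rightarrow>\<^sub>E insert \<one>\<^bsub>H\<^esub> A) \<times> B)"
    proof
      fix p assume "p \<in> ?C"
      then have p: "p \<in> carrier ?W" and le: "\<alpha> ?o p + (\<beta> ?o p + \<sigma> ?o p) \<le> R" by auto
      have \<alpha>0: "0 \<le> \<alpha> ?o p" unfolding \<alpha>_def by (rule sum_nonneg) simp
      have \<beta>0: "0 \<le> \<beta> ?o p" by (simp add: \<beta>_def)
      have partial: "(\<Sum>n<N. \<kappa> n ?o p) \<le> \<sigma> ?o p"
        unfolding \<sigma>_def by (rule sum_le_suminf) (use p \<kappa>_summable \<kappa>_nonneg in auto)
      have "0 \<le> (\<Sum>n<N. \<kappa> n ?o p)" using p \<kappa>_nonneg by (intro sum_nonneg) auto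
      with partial have \<sigma>0: "0 \<le> \<sigma> ?o p" by simp
      have "\<exists>n<N. \<kappa> n ?o p < 1 / 8"
      proof (rule ccontr)
        assume "\<not> ?thesis"
        then have "1 / 8 \<le> \<kappa> n ?o p" if "n < N" for n using that by (meson not_less)
        then have "(\<Sum>n<N. 1 / 8 :: real) \<le> (\<Sum>n<N. \<kappa> n ?o p)" by (intro sum_mono) simp
        with partial le \<alpha>0 \<beta>0 N show False by simp
      qed
      then obtain n where n: "n < N" "\<kappa> n ?o p < 1 / 8" by blast
      have D_E: "x \<in> E" if x: "x \<in> ?D ?o p" for x
      proof -
        have "norm (b x - b (snd ?o)) \<le> \<rho> n"
          using \<rho>[of ?o p x n] finD[OF W.one_closed p] x n(2) by force
        moreover have "x \<in> carrier G" using x D_sub by blast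
        ultimately show ?thesis
          using n(1) unfolding E_def by (auto simp: one_wreath_product norm_minus_commute)
      qed
      have D_A: "fst p x \<in> A" if x: "x \<in> ?D ?o p" for x
      proof -
        have "(norm (a (fst ?o x) - a (fst p x)))\<^sup>2 \<le> \<alpha> ?o p"
          unfolding \<alpha>_def using x finD[OF W.one_closed p] by (intro member_le_sum) auto
        then have "(norm (a (fst ?o x) - a (fst p x)))\<^sup>2 \<le> R" using le \<beta>0 \<sigma>0 by simp
        then have "norm (a (fst ?o x) - a (fst p x)) \<le> sqrt R" by (rule real_le_rsqrt)
        moreover have "x \<in> carrier G" using x D_sub by blast
        ultimately show ?thesis using carr[OF p] by (simp add: A_def one_wreath_product)
      qed
      have off: "fst p x = \<one>\<^bsub>H\<^esub>" if "x \<in> carrier G" "x \<notin> ?D ?o p" for x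
        using that by (auto simp: differ_def one_wreath_product)
      have p_B: "snd p \<in> B"
      proof -
        have "(norm (b \<one>\<^bsub>G\<^esub> - b (snd p)))\<^sup>2 \<le> R" using le \<alpha>0 \<sigma>0 by (simp add: \<beta>_def one_wreath_product)
        then show ?thesis using carr(1)[OF p] by (auto simp: B_def intro: real_le_rsqrt)
      qed
      have p_A: "restrict (fst p) E \<in> E \<rightarrow>\<^sub>E insert \<one>\<^bsub>H\<^esub> A"
        using D_A off by (fastforce simp: E_def)
      have "?ext (restrict (fst p) E) x = fst p x" for x
      proof (cases "x \<in> carrier G")
        case True
        have "fst p x = \<one>\<^bsub>H\<^esub>" if "x \<notin> E" using off[OF True] D_E that by blast
        with True show ?thesis by simp
      next
        case False
        have "fst p \<in> carrier G \<rightarrow>\<^sub>E carrier H"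
          using p by (simp add: carrier_wreath_product[OF assms(3)])
        then have "fst p x = undefined" using False by (rule PiE_arb)
        with False show ?thesis by simp
      qed
      then have "?ext (restrict (fst p) E) = fst p" by (rule ext)
      then have "p = (\<lambda>(u, g). (?ext u, g)) (restrict (fst p) E, snd p)"
        by (simp only: prod.case prod.collapse)
      with p_A p_B show "p \<in> (\<lambda>(u, g). (?ext u, g)) ` ((E \<rightarrow>\<^sub>E insert \<one>\<^bsub>H\<^esub> A) \<times> B)"
        by (intro image_eqI[of _ _ "(restrict (fst p) E, snd p)"] SigmaI)
    qed
    ultimately show "finite ?C" by (rule finite_subset[rotated])
  qed (use countable W.group_axioms in auto)
qed

end
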